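(* Let $n,m\ge 1$ be integers, let $f_1,\dots,f_n:\mathbb{R}^m\to\mathbb{R}$ be differentiable, $f=\frac1n\sum_{i=1}^n f_i$, $h:\mathbb{R}^m\to\mathbb{R}$, and $P=f+h$. Suppose there are constants $\mu>0$, $L>0$, $C_f\ge 0$, $C_h\ge 0$ such that: (i) $f$ is strongly convex with constant $\mu$, and $h$ is convex; (ii) $\nabla f$ is Lipschitz continuous with constant $L$; (iii) $\frac1n\sum_{i=1}^n\|\nabla f_i(\mathbf{x})-\nabla f(\mathbf{x})\|_2^2\le C_f$ for all $\mathbf{x}\in\mathbb{R}^m$; (iv) $\|\mathbf{g}\|_2^2\le C_h$ for every $\mathbf{x}\in\mathbb{R}^m$ and every subgradient $\mathbf{g}\in\partial h(\mathbf{x})$. Let $\mathbf{x}^*$ be the minimizer of $P$, let $\mathbf{x}_0\in\mathbb{R}^m$ be a given initial point, and let $\tau\ge 0$ be an integer (the maximum delay). Then there exist positive numbers $\eta(T)$, $T\ge 1$, with $\eta(T)=O(1/\sqrt{T})$, depending only on $\mu,L,\tau,T$, and a constant $C$ independent of $T$, such that for every integer $T\ge1$ the following holds: if $(\mathbf{x}_t)_{0\le t\le T}$ are the iterates generated by the DAP-SGD recursion (defined in the context) from $\mathbf{x}_0$ with constant step-size $\eta_t=\eta(T)$ for all $t$ and any delay sequence with maximum delay $\tau$, then the running average $\bar{\mathbf{x}}_T=\frac{1}{T+1}\sum_{t=0}^T\mathbf{x}_t$ satisfies $$\mathbb{E}\|\bar{\mathbf{x}}_T-\mathbf{x}^*\|_2^2\le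 \frac{C}{\sqrt{T}}.$$
   Context: Strong convexity with constant $\mu$: $f(\mathbf{x})\ge f(\mathbf{y})+\langle\nabla f(\mathbf{y}),\mathbf{x}-\mathbf{y}\rangle+\frac{\mu}{2}\|\mathbf{x}-\mathbf{y}\|_2^2$ for all $\mathbf{x},\mathbf{y}$. Proximal operator: for $\eta>0$, $\mathrm{Prox}_{\eta,h}(\mathbf{x})=\arg\min_{\mathbf{y}\in\mathbb{R}^m}\left\{\frac{1}{2\eta}\|\mathbf{y}-\mathbf{x}\|_2^2+h(\mathbf{y})\right\}$. Delay sequence with maximum delay $\tau$: a deterministic sequence of integers $d(t)$, $t\ge0$, with $\max(0,t-\tau)\le d(t)\le t$. DAP-SGD (decoupled asynchronous proximal stochastic gradient descent): at each iteration $t=0,1,2,\dots$ the master receives from a worker an update computed at the (possibly outdated) iterate $\mathbf{x}_{d(t)}$ with step-size $\eta_{d(t)}$, using a random sample index, denoted $i_{d(t)}$, which is uniformly distributed on $\{1,\dots,n\}$ and independent of $\mathbf{x}_{d(t)}$. The recursion is $$\mathbf{x}'_{d(t)}=\mathrm{Prox}_{\eta_{d(t)},h}\big(\mathbf{x}_{d(t)}-\eta_{d(t)}\nabla f_{i_{d(t)}}(\mathbf{x}_{d(t)})\big),\qquad \mathbf{x}_{t+1}=\mathbf{x}_t+\mathbf{x}'_{d(t)}-\mathbf{x}_{d(t)}.$$ Here $\mathbf{x}'_{d(t)}$ and $i_{d(t)}$ denote the quantities attached to the update received at iteration $t$. The expectation $\mathbb{E}$ is over the random sample indices. *)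

theory Defs
  imports
    "HOL-Probability.Probability"
    "HOL-Library.Poly_Mapping"
    "HOL-Library.Landau_Symbols"
begin

text \<open>
  The Euclidean spaces of all dimensions are realised as subspaces of one inner product space, the
  finitely supported sequences with the \<open>\<ell>\<^sup>2\<close> inner product. A dimension encoded in a type
  (as in \<open>real ^ 'm\<close>) could not be quantified inside a formula, so that an existentially quantified
  step size would be allowed to depend on it.
\<close>

instantiation poly_mapping :: (type, real_inner) real_inner
begin

definition scaleR_poly_mapping :: "real \<Rightarrow> ('a \<Rightarrow>\<^sub>0 'b) \<Rightarrow> ('a \<Rightarrow>\<^sub>0 'b)"
  where "scaleR_poly_mapping r x = Poly_Mapping.map (scaleR r) x"

definition inner_poly_mapping :: "('a \<Rightarrow>\<^sub>0 'b) \<Rightarrow> ('a \<Rightarrow>\<^sub>0 'b) \<Rightarrow> real"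
  where "inner_poly_mapping x y = (\<Sum>k\<in>Poly_Mapping.keys x. inner (Poly_Mapping.lookup x k) (Poly_Mapping.lookup y k))"

definition norm_poly_mapping :: "('a \<Rightarrow>\<^sub>0 'b) \<Rightarrow> real"
  where "norm_poly_mapping x = sqrt (inner x x)"

definition sgn_poly_mapping :: "('a \<Rightarrow>\<^sub>0 'b) \<Rightarrow> ('a \<Rightarrow>\<^sub>0 'b)"
  where "sgn_poly_mapping x = scaleR (inverse (norm x)) x"

definition dist_poly_mapping :: "('a \<Rightarrow>\<^sub>0 'b) \<Rightarrow> ('a \<Rightarrow>\<^sub>0 'b) \<Rightarrow> real"
  where "dist_poly_mapping x y = norm (x - y)"

definition uniformity_poly_mapping :: "(('a \<Rightarrow>\<^sub>0 'b) \<times> ('a \<Rightarrow>\<^sub>0 'b)) filter"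
  where "uniformity_poly_mapping = (INF e\<in>{0<..}. principal {(x, y). dist x y < e})"

definition open_poly_mapping :: "('a \<Rightarrow>\<^sub>0 'b) set \<Rightarrow> bool"
  where "open_poly_mapping U \<longleftrightarrow> (\<forall>x\<in>U. eventually (\<lambda>(x', y). x' = x \<longrightarrow> y \<in> U) uniformity)"

lemma lookup_scaleR: "Poly_Mapping.lookup (r *\<^sub>R x) k = r *\<^sub>R Poly_Mapping.lookup x k"
  for x :: "'a \<Rightarrow>\<^sub>0 'b"
  unfolding scaleR_poly_mapping_def by transfer (simp add: when_def)

lemma inner_poly_mapping_superset:
  fixes x y :: "'a \<Rightarrow>\<^sub>0 'b"
  assumes "finite A" "Poly_Mapping.keys x \<subseteq> A"
  shows "inner x y = (\<Sum>k\<in>A. inner (Poly_Mapping.lookup x k) (Poly_Mapping.lookup y k))"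
  unfolding inner_poly_mapping_def
  by (rule sum.mono_neutral_left) (use assms in \<open>auto simp: in_keys_iff\<close>)

instance
proof
  fix r s :: real and x y z :: "'a \<Rightarrow>\<^sub>0 'b"
  let ?K = "Poly_Mapping.keys x \<union> Poly_Mapping.keys y"
  show "r *\<^sub>R (x + y) = r *\<^sub>R x + r *\<^sub>R y"
    by (rule poly_mapping_eqI) (simp add: lookup_scaleR lookup_add scaleR_add_right)
  show "(r + s) *\<^sub>R x = r *\<^sub>R x + s *\<^sub>R x"
    by (rule poly_mapping_eqI) (simp add: lookup_scaleR lookup_add scaleR_add_left)
  show "r *\<^sub>R s *\<^sub>R x = (r * s) *\<^sub>R x"
    by (rule poly_mapping_eqI) (simp add: lookup_scaleR)
  show "1 *\<^sub>R x = x"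
    by (rule poly_mapping_eqI) (simp add: lookup_scaleR)
  show "sgn x = inverse (norm x) *\<^sub>R x"
    by (rule sgn_poly_mapping_def)
  show "dist x y = norm (x - y)"
    by (rule dist_poly_mapping_def)
  show "uniformity = (INF e\<in>{0<..}. principal {(x :: 'a \<Rightarrow>\<^sub>0 'b, y). dist x y < e})"
    by (rule uniformity_poly_mapping_def)
  show "open U \<longleftrightarrow> (\<forall>x\<in>U. eventually (\<lambda>(x', y). x' = x \<longrightarrow> y \<in> U) uniformity)"
    for U :: "('a \<Rightarrow>\<^sub>0 'b) set"
    by (rule open_poly_mapping_def)
  show "inner x y = inner y x"
    by (simp add: inner_poly_mapping_superset[of ?K] inner_commute)
  show "inner (x + y) z = inner x z + inner y z"
    using Poly_Mapping.keys_add[of x y]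
    by (simp add: inner_poly_mapping_superset[of ?K] lookup_add inner_add_left sum.distrib)
  show "inner (r *\<^sub>R x) y = r * inner x y"
  proof -
    have "Poly_Mapping.keys (r *\<^sub>R x) \<subseteq> Poly_Mapping.keys x"
      by (auto simp: in_keys_iff lookup_scaleR)
    then show ?thesis
      by (simp add: inner_poly_mapping_superset[of "Poly_Mapping.keys x"] lookup_scaleR
          sum_distrib_left)
  qed
  show "0 \<le> inner x x"
    by (simp add: inner_poly_mapping_def sum_nonneg)
  show "inner x x = 0 \<longleftrightarrow> x = 0"
  proof
    assume "inner x x = 0"
    then have "\<forall>k\<in>Poly_Mapping.keys x. inner (Poly_Mapping.lookup x k) (Poly_Mapping.lookup x k) = 0"
      by (simp add: inner_poly_mapping_def sum_nonneg_eq_0_iff)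
    then show "x = 0"
      by (auto simp: in_keys_iff intro!: poly_mapping_eqI)
  qed (simp add: inner_poly_mapping_def)
  show "norm x = sqrt (inner x x)"
    by (rule norm_poly_mapping_def)
qed

end

type_synonym fvec = "nat \<Rightarrow>\<^sub>0 real"

definition Rdim :: "nat \<Rightarrow> fvec set"
  where "Rdim m = {x. Poly_Mapping.keys x \<subseteq> {..<m}}"

text \<open>
  A function on \<open>\<real>\<^sup>m\<close> is a function on \<^typ>\<open>fvec\<close> of which only the values on \<^term>\<open>Rdim m\<close>
  matter; all the notions below are relative to that subspace.
\<close>

definition gradient :: "nat \<Rightarrow> (fvec \<Rightarrow> real) \<Rightarrow> fvec \<Rightarrow> fvec"
  where "gradient m f x =
    (THE g. g \<in> Rdim m \<and> (f has_derivative (\<lambda>v. inner g v)) (at x within Rdim m))"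

definition strongly_convex :: "nat \<Rightarrow> real \<Rightarrow> (fvec \<Rightarrow> real) \<Rightarrow> bool"
  where "strongly_convex m \<mu> f \<longleftrightarrow> (\<forall>x\<in>Rdim m. \<forall>y\<in>Rdim m.
    f x \<ge> f y + inner (gradient m f y) (x - y) + \<mu> / 2 * (norm (x - y))\<^sup>2)"

definition subdifferential :: "nat \<Rightarrow> (fvec \<Rightarrow> real) \<Rightarrow> fvec \<Rightarrow> fvec set"
  where "subdifferential m h x = {g \<in> Rdim m. \<forall>y\<in>Rdim m. h y \<ge> h x + inner g (y - x)}"

text \<open>
  The set of minimizers; it is a singleton when \<open>h\<close> is convex and \<open>\<eta> > 0\<close>.
\<close>

definition Prox :: "nat \<Rightarrow> real \<Rightarrow> (fvec \<Rightarrow> real) \<Rightarrow> fvec \<Rightarrow> fvec set"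
  where "Prox m \<eta> h x =
    {y. is_arg_min (\<lambda>y. 1 / (2 * \<eta>) * (norm (y - x))\<^sup>2 + h y) (\<lambda>y. y \<in> Rdim m) y}"

definition average :: "nat \<Rightarrow> (nat \<Rightarrow> fvec \<Rightarrow> real) \<Rightarrow> fvec \<Rightarrow> real"
  where "average n f x = 1 / real n * (\<Sum>i=1..n. f i x)"

text \<open>Truncated subtraction of natural numbers is \<open>max (0, t - \<tau>)\<close>.\<close>

definition delay_seq :: "nat \<Rightarrow> (nat \<Rightarrow> nat) \<Rightarrow> bool"
  where "delay_seq \<tau> d \<longleftrightarrow> (\<forall>t. t - \<tau> \<le> d t \<and> d t \<le> t)"

text \<open>
  The library's \<open>indep_var\<close> only covers two random variables with values in the same type.
\<close>

definition indep_rvs ::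
    "'w measure \<Rightarrow> 'a measure \<Rightarrow> ('w \<Rightarrow> 'a) \<Rightarrow> 'b measure \<Rightarrow> ('w \<Rightarrow> 'b) \<Rightarrow> bool"
  where "indep_rvs M A X B Y \<longleftrightarrow>
    X \<in> measurable M A \<and> Y \<in> measurable M B \<and>
    prob_space.indep_set M {X -` S \<inter> space M |S. S \<in> sets A} {Y -` S \<inter> space M |S. S \<in> sets B}"

text \<open>
  \<open>\<omega> t\<close> is the sample index of the update received at iteration \<open>t\<close>, and \<open>M\<close> is the joint law of
  the sequence of sample indices. The law is arbitrary apart from the requirement that \<open>\<omega> t\<close> is
  uniform and independent of the iterate \<open>x (d t)\<close> at which the update is computed.
\<close>

definition dap_sgd ::
    "nat \<Rightarrow> nat \<Rightarrow> (nat \<Rightarrow> fvec \<Rightarrow> real) \<Rightarrow> (fvec \<Rightarrow> real) \<Rightarrow> (nat \<Rightarrow> real) \<Rightarrow> (nat \<Rightarrow> nat) \<Rightarrow>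
     fvec \<Rightarrow> nat \<Rightarrow> (nat \<Rightarrow> nat) measure \<Rightarrow> (nat \<Rightarrow> (nat \<Rightarrow> nat) \<Rightarrow> fvec) \<Rightarrow> bool"
  where "dap_sgd m n f h \<eta> d x0 T M x \<longleftrightarrow>
    prob_space M \<and> sets M = sets (PiM UNIV (\<lambda>_. count_space {1..n})) \<and>
    (\<forall>\<omega>\<in>space M. x 0 \<omega> = x0) \<and>
    (\<forall>t<T.
      distr M (count_space {1..n}) (\<lambda>\<omega>. \<omega> t) = uniform_count_measure {1..n} \<and>
      indep_rvs M borel (x (d t)) (count_space {1..n}) (\<lambda>\<omega>. \<omega> t) \<and>
      (\<forall>\<omega>\<in>space M.
        \<exists>x'\<in>Prox m (\<eta> (d t)) h
                 (x (d t) \<omega> - \<eta> (d t) *\<^sub>R gradient m (f (\<omega> t)) (x (d t) \<omega>)).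
          x (Suc t) \<omega> = x t \<omega> + x' - x (d t) \<omega>))"

definition running_average :: "nat \<Rightarrow> (nat \<Rightarrow> 'w \<Rightarrow> fvec) \<Rightarrow> 'w \<Rightarrow> fvec"
  where "running_average T x \<omega> = (1 / real (T + 1)) *\<^sub>R (\<Sum>t=0..T. x t \<omega>)"

end

theory Submission
  imports Defs
begin

text \<open>
  The step is \<open>x (Suc t) = x t - \<eta> G t\<close> with \<open>G t\<close> a stochastic gradient at \<open>x (d t)\<close> plus a
  subgradient of \<open>h\<close> at the proximal point. Since \<open>- \<nabla>f(x\<^sup>*)\<close> is a subgradient of \<open>h\<close> at \<open>x\<^sup>*\<close>,
  strong monotonicity of \<open>\<nabla>f\<close> and monotonicity of the subdifferential of \<open>h\<close> give a decrease
  \<open>2 \<eta> \<mu> E\<parallel>x (d t) - x\<^sup>*\<parallel>\<^sup>2\<close> of \<open>E\<parallel>x t - x\<^sup>*\<parallel>\<^sup>2\<close>, up to an error of order \<open>\<eta>\<^sup>2\<close> in the second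
  moments of \<open>G\<close> over the window of the last \<open>\<tau>\<close> iterations; independence is only needed between
  the sample index and \<open>x (d t)\<close>. These moments grow with \<open>L\<^sup>2 E\<parallel>x (d s) - x\<^sup>*\<parallel>\<^sup>2\<close>, and as each
  iteration lies in at most \<open>\<tau>\<close> later windows, summation over \<open>t\<close> lets the decrease absorb that
  part once \<open>6 (1 + \<tau>) L\<^sup>2 \<eta> \<le> \<mu>\<close>. The step size \<open>\<eta> = c / \<surd>T\<close> balances the rest.
\<close>

section \<open>Gradients on \<open>Rdim m\<close>\<close>

lemma Rdim_iff: "x \<in> Rdim m \<longleftrightarrow> (\<forall>k\<ge>m. Poly_Mapping.lookup x k = 0)"
  unfolding Rdim_def mem_Collect_eq subset_iff in_keys_iff lessThan_iff by (meson not_less)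

lemma subspace_Rdim: "subspace (Rdim m)"
  unfolding subspace_def by (simp add: Rdim_iff lookup_add lookup_scaleR)

lemma Rdim_expand:
  fixes x :: fvec
  assumes "x \<in> Rdim m"
  shows "x = (\<Sum>k<m. Poly_Mapping.lookup x k *\<^sub>R Poly_Mapping.single k 1)"
proof (rule poly_mapping_eqI)
  fix j
  have "(\<Sum>k<m. Poly_Mapping.lookup x k * Poly_Mapping.lookup (Poly_Mapping.single k (1 :: real)) j)
      = (\<Sum>k<m. if k = j then Poly_Mapping.lookup x j else 0)"
    by (intro sum.cong refl) (auto simp: lookup_single when_def)
  also have "\<dots> = Poly_Mapping.lookup x j"
    using assms by (auto simp: Rdim_iff not_less)
  finally show "Poly_Mapping.lookup x j
      = Poly_Mapping.lookup (\<Sum>k<m. Poly_Mapping.lookup x k *\<^sub>R Poly_Mapping.single k 1) j"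
    by (simp add: lookup_sum lookup_scaleR)
qed

lemma inner_single: "inner (Poly_Mapping.single k 1) x = Poly_Mapping.lookup x k" for x :: fvec
  by (simp add: inner_poly_mapping_def)

text \<open>Riesz representation by coordinates: the values of the derivative on the unit vectors
  below \<open>m\<close> are the entries of \<open>g\<close>. The two linear maps agree only on
  \<open>Rdim m\<close>, which suffices because the difference quotients are taken within that
  subspace.\<close>

lemma differentiable_has_gradient:
  assumes "f differentiable (at x within Rdim m)" and x: "x \<in> Rdim m"
  shows "\<exists>g\<in>Rdim m. (f has_derivative (\<lambda>v. inner g v)) (at x within Rdim m)"
proof -
  from assms obtain D where D: "(f has_derivative D) (at x within Rdim m)"
    by (auto simp: differentiable_def)
  then interpret D: bounded_linear D by (rule has_derivative_bounded_linear)
  define g :: fvec where "g = (\<Sum>k<m. D (Poly_Mapping.single k 1) *\<^sub>R Poly_Mapping.single k 1)"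
  have gR: "g \<in> Rdim m"
    by (auto simp: g_def Rdim_iff lookup_sum lookup_scaleR lookup_single when_def)
  have gD: "inner g v = D v" if "v \<in> Rdim m" for v
  proof -
    have "D v = (\<Sum>k<m. Poly_Mapping.lookup v k *\<^sub>R D (Poly_Mapping.single k 1))"
      by (subst Rdim_expand[OF that]) (simp add: D.sum D.scaleR)
    then show ?thesis
      by (simp add: g_def inner_sum_left inner_single mult.commute)
  qed
  have eq: "\<And>y. y \<in> Rdim m \<Longrightarrow>
      (f y - f x - D (y - x)) /\<^sub>R norm (y - x) = (f y - f x - inner g (y - x)) /\<^sub>R norm (y - x)"
    using gD x subspace_diff[OF subspace_Rdim] by metis
  have "((\<lambda>y. (f y - f x - D (y - x)) /\<^sub>R norm (y - x)) \<longlongrightarrow> 0) (at x within Rdim m)"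
    using D by (simp add: has_derivative_at_within)
  then have "((\<lambda>y. (f y - f x - inner g (y - x)) /\<^sub>R norm (y - x)) \<longlongrightarrow> 0) (at x within Rdim m)"
    by (rule Lim_transform_eventually)
      (unfold eventually_at_filter, intro always_eventually allI impI eq)
  then have "(f has_derivative (\<lambda>v. inner g v)) (at x within Rdim m)"
    by (simp add: has_derivative_at_within bounded_linear_inner_right)
  with gR show ?thesis by blast
qed

text \<open>Both candidates are tested on the line through \<open>x\<close> in direction
  \<open>g - g'\<close>. It stays in \<open>Rdim m\<close>, so the question reduces to uniqueness of
  the derivative of a function of one real variable.\<close>

lemma has_gradient_unique:
  assumes g: "(f has_derivative (\<lambda>v. inner g v)) (at x within Rdim m)" "g \<in> Rdim m"
    and g': "(f has_derivative (\<lambda>v. inner g' v)) (at x within Rdim m)" "g' \<in> Rdim m"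
    and x: "x \<in> Rdim m"
  shows "g = g'"
proof -
  define l where "l t = x + t *\<^sub>R (g - g')" for t :: real
  have l: "(l has_derivative (\<lambda>t. t *\<^sub>R (g - g'))) (at 0)"
    unfolding l_def by (auto intro!: derivative_eq_intros)
  have lR: "range l \<subseteq> Rdim m"
    using g(2) g'(2) x by (auto simp: l_def intro!: subspace_add subspace_scale subspace_diff subspace_Rdim)
  have *: "((\<lambda>t. f (l t)) has_derivative (\<lambda>t. inner k (t *\<^sub>R (g - g')))) (at 0)"
    if "(f has_derivative (\<lambda>v. inner k v)) (at x within Rdim m)" for k
  proof -
    have "(f has_derivative (\<lambda>v. inner k v)) (at (l 0) within range l)"
      using that lR by (auto simp: l_def intro: has_derivative_subset)
    from diff_chain_within[OF l this] show ?thesis by (simp add: o_def)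
  qed
  have "(\<lambda>t. inner g (t *\<^sub>R (g - g'))) = (\<lambda>t. inner g' (t *\<^sub>R (g - g')))"
    by (rule has_derivative_unique[OF *[OF g(1)] *[OF g'(1)]])
  from fun_cong[OF this, of 1] have "inner (g - g') (g - g') = 0"
    by (simp add: inner_diff_left)
  then show ?thesis by simp
qed

lemma gradient_eqI:
  assumes "(f has_derivative (\<lambda>v. inner g v)) (at x within Rdim m)" "g \<in> Rdim m" "x \<in> Rdim m"
  shows "gradient m f x = g"
  unfolding gradient_def using assms has_gradient_unique by (intro the_equality) blast+

lemma
  assumes "f differentiable (at x within Rdim m)" "x \<in> Rdim m"
  shows gradient_in_Rdim: "gradient m f x \<in> Rdim m"
    and has_derivative_gradient:
      "(f has_derivative (\<lambda>v. inner (gradient m f x) v)) (at x within Rdim m)"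
  using differentiable_has_gradient[OF assms] gradient_eqI[OF _ _ assms(2)] by auto

lemma gradient_average:
  assumes "\<And>i. i \<in> {1..n} \<Longrightarrow> f i differentiable_on Rdim m" "x \<in> Rdim m"
  shows "gradient m (average n f) x = (1 / real n) *\<^sub>R (\<Sum>i=1..n. gradient m (f i) x)"
proof (rule gradient_eqI)
  have d: "f i differentiable (at x within Rdim m)" if "i \<in> {1..n}" for i
    using assms that by (auto simp: differentiable_on_def)
  have "((\<lambda>x. 1 / real n * (\<Sum>i=1..n. f i x)) has_derivative
      (\<lambda>v. 1 / real n * (\<Sum>i=1..n. inner (gradient m (f i) x) v))) (at x within Rdim m)"
    by (intro has_derivative_mult_right has_derivative_sum has_derivative_gradient d assms(2))
  moreover have "inner ((1 / real n) *\<^sub>R (\<Sum>i=1..n. gradient m (f i) x))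
      = (\<lambda>v. 1 / real n * (\<Sum>i=1..n. inner (gradient m (f i) x) v))"
    by (rule ext) (simp add: inner_sum_left)
  ultimately show "(average n f has_derivative
      inner ((1 / real n) *\<^sub>R (\<Sum>i=1..n. gradient m (f i) x))) (at x within Rdim m)"
    by (simp only: average_def[abs_def])
  show "(1 / real n) *\<^sub>R (\<Sum>i=1..n. gradient m (f i) x) \<in> Rdim m"
    by (intro subspace_scale subspace_sum subspace_Rdim gradient_in_Rdim d assms(2))
qed (rule assms(2))

section \<open>Optimality conditions\<close>

text \<open>Division by \<open>s\<close> and the limit from the right at 0. This turns minimality
  along a segment into a first-order condition.\<close>

lemma nonneg_if_quadratic_nonneg:
  fixes a b :: real
  assumes "\<And>s. 0 < s \<Longrightarrow> s \<le> 1 \<Longrightarrow> 0 \<le> s * a + s\<^sup>2 * b"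
  shows "0 \<le> a"
proof (rule tendsto_lowerbound)
  show "((\<lambda>s. a + s * b) \<longlongrightarrow> a) (at_right 0)"
    by (auto intro!: tendsto_eq_intros)
  have "0 \<le> a + s * b" if "0 < s" "s < 1" for s
  proof -
    have "0 \<le> s * (a + s * b)"
      using assms[of s] that by (simp add: algebra_simps power2_eq_square)
    then show ?thesis using that by (simp add: zero_le_mult_iff)
  qed
  then show "\<forall>\<^sub>F s in at_right 0. 0 \<le> a + s * b"
    by (auto simp: eventually_at_right_field intro: exI[of _ 1])
qed simp

lemma subdifferential_monotone:
  assumes "g \<in> subdifferential m h x" "g' \<in> subdifferential m h y" "x \<in> Rdim m" "y \<in> Rdim m"
  shows "inner (g - g') (x - y) \<ge> 0"
proof -
  have "h y \<ge> h x + inner g (y - x)" "h x \<ge> h y + inner g' (x - y)"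
    using assms by (auto simp: subdifferential_def)
  then show ?thesis by (simp add: algebra_simps inner_diff_left inner_diff_right)
qed

lemma convex_on_segment:
  assumes "convex_on A h" "x \<in> A" "y \<in> A" "0 < s" "s \<le> (1::real)"
  shows "h (x + s *\<^sub>R (y - x)) \<le> h x + s * (h y - h x)"
  using convex_onD[OF assms(1), of s x y] assms by (simp add: algebra_simps)

text \<open>The minimizer \<open>y\<close> is compared with the points of the segment from
  \<open>y\<close> to \<open>z\<close>. Convexity bounds the change of \<open>h\<close> linearly in
  \<open>s\<close>, and the quadratic term contributes a linear part plus a multiple of
  \<open>s\<^sup>2\<close>. The total linear coefficient must be nonnegative, which is the
  subgradient inequality.\<close>

lemma subdifferential_Prox:
  assumes h: "convex_on (Rdim m) h" and \<eta>: "\<eta> > 0" and x: "x \<in> Rdim m" and y: "y \<in> Prox m \<eta> h x"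
  shows "(1 / \<eta>) *\<^sub>R (x - y) \<in> subdifferential m h y"
proof -
  have yR: "y \<in> Rdim m" using y by (simp add: Prox_def is_arg_min_def)
  have min: "1 / (2 * \<eta>) * (norm (y - x))\<^sup>2 + h y \<le> 1 / (2 * \<eta>) * (norm (z - x))\<^sup>2 + h z"
    if "z \<in> Rdim m" for z
    using y that by (auto simp: Prox_def is_arg_min_linorder)
  have "0 \<le> inner (y - x) (z - y) / \<eta> + (h z - h y)" if z: "z \<in> Rdim m" for z
  proof (rule nonneg_if_quadratic_nonneg[where b = "1 / (2 * \<eta>) * (norm (z - y))\<^sup>2"])
    fix s :: real assume s: "0 < s" "s \<le> 1"
    have R: "y + s *\<^sub>R (z - y) \<in> Rdim m"
      by (intro subspace_add subspace_scale subspace_diff subspace_Rdim yR z)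
    have "(norm (y + s *\<^sub>R (z - y) - x))\<^sup>2
        = (norm (y - x))\<^sup>2 + 2 * s * inner (y - x) (z - y) + s\<^sup>2 * (norm (z - y))\<^sup>2"
      unfolding power2_norm_eq_inner
      by (simp add: inner_add_left inner_add_right inner_diff_left inner_diff_right
          inner_commute power2_eq_square algebra_simps)
    then have "1 / (2 * \<eta>) * (norm (y + s *\<^sub>R (z - y) - x))\<^sup>2 = 1 / (2 * \<eta>) * (norm (y - x))\<^sup>2
        + s * (inner (y - x) (z - y) / \<eta>) + s\<^sup>2 * (1 / (2 * \<eta>) * (norm (z - y))\<^sup>2)"
      using \<eta> by (simp add: field_simps)
    with min[OF R] convex_on_segment[OF h yR z s]
    show "0 \<le> s * (inner (y - x) (z - y) / \<eta> + (h z - h y)) + s\<^sup>2 * (1 / (2 * \<eta>) * (norm (z - y))\<^sup>2)"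
      by (simp add: algebra_simps)
  qed
  moreover have "(1 / \<eta>) *\<^sub>R (x - y) \<in> Rdim m"
    by (intro subspace_scale subspace_diff subspace_Rdim yR x)
  ultimately show ?thesis
    by (auto simp: subdifferential_def inner_diff_left diff_divide_distrib add_divide_distrib algebra_simps)
qed

text \<open>For two minimizers the subgradients from \<open>subdifferential_Prox\<close> differ by a
  negative multiple of \<open>y - z\<close>, so monotonicity forces \<open>y = z\<close>.\<close>

lemma Prox_unique:
  assumes "convex_on (Rdim m) h" "\<eta> > 0" "x \<in> Rdim m" "y \<in> Prox m \<eta> h x" "z \<in> Prox m \<eta> h x"
  shows "y = z"
proof -
  have "y \<in> Rdim m" "z \<in> Rdim m" using assms by (auto simp: Prox_def is_arg_min_def)
  then have "0 \<le> inner ((1 / \<eta>) *\<^sub>R (x - y) - (1 / \<eta>) *\<^sub>R (x - z)) (y - z)"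
    using assms by (intro subdifferential_monotone[of _ m h] subdifferential_Prox)
  also have "\<dots> = - ((norm (y - z))\<^sup>2 / \<eta>)"
    using assms(2) by (simp add: power2_norm_eq_inner inner_diff_left inner_diff_right
        inner_commute field_simps)
  finally have "(norm (y - z))\<^sup>2 \<le> 0"
    using assms(2) by (simp add: field_simps)
  then show ?thesis by simp
qed

text \<open>The defining inequality is added to itself with \<open>x\<close> and \<open>y\<close>
  exchanged; the two halves of \<mu> add up.\<close>

lemma strongly_convex_monotone:
  assumes "strongly_convex m \<mu> F" "x \<in> Rdim m" "y \<in> Rdim m"
  shows "inner (gradient m F x - gradient m F y) (x - y) \<ge> \<mu> * (norm (x - y))\<^sup>2"
proof -
  have "F x \<ge> F y + inner (gradient m F y) (x - y) + \<mu> / 2 * (norm (x - y))\<^sup>2"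
    "F y \<ge> F x + inner (gradient m F x) (y - x) + \<mu> / 2 * (norm (y - x))\<^sup>2"
    using assms by (auto simp: strongly_convex_def)
  then show ?thesis
    by (simp add: norm_minus_commute[of y x] inner_diff_left inner_diff_right algebra_simps)
qed

text \<open>Fermat's rule for \<open>F + h\<close>. Moving a fraction \<open>s\<close> of the way
  from \<open>xs\<close> towards \<open>z\<close> cannot decrease the sum; \<open>h\<close> grows at
  most linearly by convexity, and \<open>F\<close> is linearised at \<open>xs\<close> with an error
  of order \<open>s\<^sup>2\<close>.\<close>

lemma minus_gradient_in_subdifferential:
  assumes F: "strongly_convex m \<mu> F" "\<mu> > 0" and h: "convex_on (Rdim m) h"
    and L: "L-lipschitz_on (Rdim m) (gradient m F)"
    and min: "is_arg_min (\<lambda>x. F x + h x) (\<lambda>x. x \<in> Rdim m) xs"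
    and R: "gradient m F xs \<in> Rdim m"
  shows "- gradient m F xs \<in> subdifferential m h xs"
proof -
  have xsR: "xs \<in> Rdim m" using min by (simp add: is_arg_min_def)
  have "0 \<le> inner (gradient m F xs) (z - xs) + (h z - h xs)" if z: "z \<in> Rdim m" for z
  proof (rule nonneg_if_quadratic_nonneg[where b = "L * (norm (z - xs))\<^sup>2"])
    fix s :: real assume s: "0 < s" "s \<le> 1"
    define w where "w = xs + s *\<^sub>R (z - xs)"
    have wR: "w \<in> Rdim m"
      unfolding w_def by (intro subspace_add subspace_scale subspace_diff subspace_Rdim xsR z)
    \<comment> \<open>The convexity inequality is based at \<open>w\<close>, since this is what
      bounds \<open>F w - F xs\<close> from above. The Lipschitz estimate below moves the gradient
      from \<open>w\<close> back to \<open>xs\<close>.\<close>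
    have "F w + inner (gradient m F w) (xs - w) \<le> F w + inner (gradient m F w) (xs - w) + \<mu> / 2 * (norm (xs - w))\<^sup>2"
      using F(2) by simp
    also have "\<dots> \<le> F xs"
      using F xsR wR by (auto simp: strongly_convex_def)
    finally have "F w - F xs \<le> s * inner (gradient m F w) (z - xs)"
      by (simp add: w_def)
    also have "inner (gradient m F w) (z - xs)
        = inner (gradient m F xs) (z - xs) + inner (gradient m F w - gradient m F xs) (z - xs)"
      by (simp add: inner_diff_left)
    also have "inner (gradient m F w - gradient m F xs) (z - xs)
        \<le> norm (gradient m F w - gradient m F xs) * norm (z - xs)"
      by (rule norm_cauchy_schwarz)
    also have "norm (gradient m F w - gradient m F xs) \<le> L * (s * norm (z - xs))"
      using lipschitz_onD[OF L wR xsR] s by (simp add: dist_norm w_def)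
    finally have 1: "F w - F xs \<le> s * (inner (gradient m F xs) (z - xs) + L * (s * norm (z - xs)) * norm (z - xs))"
      using s by (simp add: mult_left_mono mult_right_mono)
    have 2: "F xs + h xs \<le> F w + h w"
      using min wR by (auto simp: is_arg_min_linorder)
    have 3: "h w \<le> h xs + s * (h z - h xs)"
      unfolding w_def by (rule convex_on_segment[OF h xsR z s])
    from 1 2 3
    show "0 \<le> s * (inner (gradient m F xs) (z - xs) + (h z - h xs)) + s\<^sup>2 * (L * (norm (z - xs))\<^sup>2)"
      by (simp add: algebra_simps power2_eq_square)
  qed
  then show ?thesis
    using subspace_neg[OF subspace_Rdim R] by (force simp: subdifferential_def)
qed

section \<open>Deterministic estimates\<close>

lemma norm_sum_power2_le:
  fixes v :: "'i \<Rightarrow> 'a :: real_normed_vector"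
  shows "(norm (sum v A))\<^sup>2 \<le> real (card A) * (\<Sum>i\<in>A. (norm (v i))\<^sup>2)"
proof -
  have "(norm (sum v A))\<^sup>2 \<le> (\<Sum>i\<in>A. norm (v i))\<^sup>2"
    by (intro power_mono norm_sum norm_ge_zero)
  also have "\<dots> \<le> real (card A) * (\<Sum>i\<in>A. (norm (v i))\<^sup>2)"
    using sum_squared_le_sum_of_squares[of "\<lambda>i. norm (v i)" A] 
    by (cases "finite A") (auto simp: mult.commute)
  finally show ?thesis .
qed

text \<open>Exchange of the two sums: a fixed \<open>s\<close> lies in the window of
  \<open>t\<close> only for \<open>s < t\<close> and \<open>t \<le> s + \<tau>\<close>, which leaves
  at most \<tau> values of \<open>t\<close>.\<close>

lemma sum_window_le:
  fixes \<gamma> :: "nat \<Rightarrow> real"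
  assumes "\<And>s. s < N \<Longrightarrow> \<gamma> s \<ge> 0"
  shows "(\<Sum>t<N. \<Sum>s=t-\<tau>..<t. \<gamma> s) \<le> real \<tau> * (\<Sum>s<N. \<gamma> s)"
proof -
  have "(\<Sum>t<N. \<Sum>s=t-\<tau>..<t. \<gamma> s) = (\<Sum>t<N. \<Sum>s | s \<in> {..<N} \<and> t - \<tau> \<le> s \<and> s < t. \<gamma> s)"
    by (intro sum.cong refl) auto
  also have "\<dots> = (\<Sum>s<N. \<Sum>t | t \<in> {..<N} \<and> t - \<tau> \<le> s \<and> s < t. \<gamma> s)"
    by (rule sum.swap_restrict) auto
  also have "\<dots> \<le> (\<Sum>s<N. real \<tau> * \<gamma> s)"
  proof (rule sum_mono)
    fix s assume s: "s \<in> {..<N}"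
    have "card {t \<in> {..<N}. t - \<tau> \<le> s \<and> s < t} \<le> card {s<..s+\<tau>}"
      by (rule card_mono) auto
    then show "(\<Sum>t | t \<in> {..<N} \<and> t - \<tau> \<le> s \<and> s < t. \<gamma> s) \<le> real \<tau> * \<gamma> s"
      using assms[of s] s by (simp add: mult_right_mono)
  qed
  finally show ?thesis by (simp add: sum_distrib_left)
qed

text \<open>Applied with \<open>a\<close> the expected squared error, \<open>b\<close> the same at
  the delayed index and \<gamma> the second moment of the update direction. After telescoping, the
  growth of \<gamma> with \<open>b\<close> costs a multiple of \<open>\<eta>\<^sup>2\<close> times
  the sum of \<open>b\<close>, which a small step size absorbs into the decrease.\<close>

lemma delayed_recursion_bound:
  fixes a b \<gamma> :: "nat \<Rightarrow> real"
  assumes a: "\<And>t. t < N \<Longrightarrow>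
      a (Suc t) \<le> a t - 2 * \<eta> * \<mu> * b t + \<eta>\<^sup>2 * (U + (2 + real \<tau>) * \<gamma> t + (\<Sum>s=t-\<tau>..<t. \<gamma> s))"
    and \<gamma>: "\<And>t. t < N \<Longrightarrow> 0 \<le> \<gamma> t" "\<And>t. t < N \<Longrightarrow> \<gamma> t \<le> 3 * L\<^sup>2 * b t + K"
    and b: "\<And>t. t < N \<Longrightarrow> 0 \<le> b t"
    and \<eta>: "\<eta> > 0" "6 * (1 + real \<tau>) * L\<^sup>2 * \<eta> \<le> \<mu>"
  shows "a N + \<eta> * \<mu> * (\<Sum>t<N. b t) \<le> a 0 + \<eta>\<^sup>2 * real N * (U + 2 * (1 + real \<tau>) * K)"
proof -
  define B where "B = (\<Sum>t<N. b t)"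
  have B: "B \<ge> 0" unfolding B_def using b by (auto intro: sum_nonneg)
  have S: "(\<Sum>t<N. \<gamma> t) \<le> 3 * L\<^sup>2 * B + real N * K"
    using sum_mono[of "{..<N}" \<gamma> "\<lambda>t. 3 * L\<^sup>2 * b t + K"] \<gamma>(2)
    by (simp add: B_def sum.distrib sum_distrib_left)
  have "a N - a 0 = (\<Sum>t<N. a (Suc t) - a t)"
    by (simp add: sum_lessThan_telescope)
  also have "\<dots> \<le> (\<Sum>t<N. - 2 * \<eta> * \<mu> * b t
      + \<eta>\<^sup>2 * (U + (2 + real \<tau>) * \<gamma> t + (\<Sum>s=t-\<tau>..<t. \<gamma> s)))"
    using a by (intro sum_mono) (simp add: algebra_simps)
  also have "\<dots> = - 2 * \<eta> * \<mu> * B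
      + \<eta>\<^sup>2 * (real N * U + (2 + real \<tau>) * (\<Sum>t<N. \<gamma> t) + (\<Sum>t<N. \<Sum>s=t-\<tau>..<t. \<gamma> s))"
    by (simp add: B_def sum.distrib sum_subtractf sum_distrib_left algebra_simps)
  also have "\<dots> \<le> - 2 * \<eta> * \<mu> * B
      + \<eta>\<^sup>2 * (real N * U + (2 + real \<tau>) * (\<Sum>t<N. \<gamma> t) + real \<tau> * (\<Sum>t<N. \<gamma> t))"
    using sum_window_le[of N \<gamma> \<tau>] \<gamma>(1) by (simp add: mult_left_mono)
  \<comment> \<open>The coefficient is \<open>2 + \<tau>\<close> from the current terms plus \<tau>
    from the windows.\<close>
  also have "\<dots> = - 2 * \<eta> * \<mu> * B + \<eta>\<^sup>2 * (real N * U + 2 * (1 + real \<tau>) * (\<Sum>t<N. \<gamma> t))"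
    by (simp add: algebra_simps)
  also have "\<dots> \<le> - 2 * \<eta> * \<mu> * B
      + \<eta>\<^sup>2 * (real N * U + 2 * (1 + real \<tau>) * (3 * L\<^sup>2 * B + real N * K))"
    using S by (intro add_left_mono mult_left_mono) auto
  also have "\<dots> = - 2 * \<eta> * \<mu> * B + (6 * (1 + real \<tau>) * L\<^sup>2 * \<eta>) * (\<eta> * B)
      + \<eta>\<^sup>2 * real N * (U + 2 * (1 + real \<tau>) * K)"
    by (simp add: algebra_simps power2_eq_square)
  \<comment> \<open>Half of the decrease \<open>2 * \<eta> * \<mu> * B\<close> pays for the growth
    of \<gamma>; the other half remains in the conclusion.\<close>
  also have "(6 * (1 + real \<tau>) * L\<^sup>2 * \<eta>) * (\<eta> * B) \<le> \<mu> * (\<eta> * B)"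
    using \<eta> B by (intro mult_right_mono) auto
  finally show ?thesis by (simp add: B_def algebra_simps)
qed

text \<open>Here \<open>e\<close> is the error of the delayed iterate, \<open>r\<close> the drift
  since then, and \<open>w\<close>, \<xi>, \<open>u\<close> are the gradient difference, the noise
  and the subgradient difference. The sign of \<open>inner u\<close> is known only at the error
  \<open>e - \<eta> *\<^sub>R G\<close> of the proximal point. Moving it to \<open>e\<close> costs
  \<open>\<eta> * inner u G\<close>, hence a term of order \<open>\<eta>\<^sup>2\<close> in the
  square.\<close>

lemma perturbed_step_bound:
  fixes e r w \<xi> u G :: "'a :: real_inner"
  assumes G: "G = w + \<xi> + u" and w: "inner w e \<ge> \<mu> * (norm e)\<^sup>2"
    and u: "inner u (e - \<eta> *\<^sub>R G) \<ge> 0" "(norm u)\<^sup>2 \<le> U" and \<eta>: "\<eta> > 0"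
  shows "(norm (e + r - \<eta> *\<^sub>R G))\<^sup>2 \<le> (norm (e + r))\<^sup>2 - 2 * \<eta> * \<mu> * (norm e)\<^sup>2 - 2 * \<eta> * inner \<xi> e
    + \<eta>\<^sup>2 * (U + 2 * (norm G)\<^sup>2) - 2 * \<eta> * inner G r"
proof -
  have "- (2 * inner u G) \<le> (norm u)\<^sup>2 + (norm G)\<^sup>2"
    using zero_le_power2[of "norm (u + G)"] unfolding power2_norm_eq_inner
    by (simp add: inner_add_left inner_add_right inner_commute)
  with u(2) have "2 * inner u G \<ge> - (U + (norm G)\<^sup>2)" by linarith
  then have "\<eta> * (2 * inner u G) \<ge> \<eta> * - (U + (norm G)\<^sup>2)"
    using \<eta> by (intro mult_left_mono) auto
  moreover have "inner u e \<ge> \<eta> * inner u G"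
    using u(1) by (simp add: inner_diff_right)
  ultimately have "2 * inner G e \<ge> 2 * \<mu> * (norm e)\<^sup>2 + 2 * inner \<xi> e - \<eta> * (U + (norm G)\<^sup>2)"
    using w arg_cong[OF G, of "\<lambda>v. inner v e"] by (simp add: inner_add_left algebra_simps)
  then have "\<eta> * (2 * inner G e) \<ge> \<eta> * (2 * \<mu> * (norm e)\<^sup>2 + 2 * inner \<xi> e - \<eta> * (U + (norm G)\<^sup>2))"
    using \<eta> by (intro mult_left_mono) auto
  moreover have "(norm (e + r - \<eta> *\<^sub>R G))\<^sup>2
      = (norm (e + r))\<^sup>2 - \<eta> * (2 * inner G e) - 2 * \<eta> * inner G r + \<eta>\<^sup>2 * (norm G)\<^sup>2"
    unfolding power2_norm_eq_inner
    by (simp add: inner_add_left inner_add_right inner_diff_left inner_diff_right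
        inner_commute power2_eq_square algebra_simps)
  ultimately show ?thesis by (simp add: algebra_simps power2_eq_square)
qed

text \<open>The drift is itself \<eta> times a sum of at most \<tau> earlier directions, so its
  product with the current step is of order \<open>\<eta>\<^sup>2\<close>. Young's inequality on
  each pair of directions avoids any appeal to independence between steps.\<close>

lemma delayed_inner_bound:
  fixes G :: "nat \<Rightarrow> 'a :: real_inner"
  assumes "\<eta> > 0" "t - \<tau> \<le> k" "k \<le> t"
  shows "- 2 * \<eta> * inner (G t) (- (\<eta> *\<^sub>R (\<Sum>s=k..<t. G s)))
    \<le> \<eta>\<^sup>2 * (real \<tau> * (norm (G t))\<^sup>2 + (\<Sum>s=t-\<tau>..<t. (norm (G s))\<^sup>2))"
proof -
  have "2 * inner (G t) (\<Sum>s=k..<t. G s) = (\<Sum>s=k..<t. 2 * inner (G t) (G s))"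
    by (simp add: inner_sum_right sum_distrib_left)
  also have "\<dots> \<le> (\<Sum>s=k..<t. (norm (G t))\<^sup>2 + (norm (G s))\<^sup>2)"
  proof (rule sum_mono)
    show "2 * inner (G t) (G s) \<le> (norm (G t))\<^sup>2 + (norm (G s))\<^sup>2" for s
      using zero_le_power2[of "norm (G t - G s)"] unfolding power2_norm_eq_inner
      by (simp add: inner_diff_left inner_diff_right inner_commute)
  qed
  also have "\<dots> = real (t - k) * (norm (G t))\<^sup>2 + (\<Sum>s=k..<t. (norm (G s))\<^sup>2)"
    by (simp add: sum.distrib)
  \<comment> \<open>Enlarging the window from \<open>k\<close> down to \<open>t - \<tau>\<close>
    removes the dependence on the actual delay.\<close>
  also have "\<dots> \<le> real \<tau> * (norm (G t))\<^sup>2 + (\<Sum>s=t-\<tau>..<t. (norm (G s))\<^sup>2)"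
    using assms by (intro add_mono mult_right_mono sum_mono2) auto
  finally have "\<eta>\<^sup>2 * (2 * inner (G t) (\<Sum>s=k..<t. G s))
      \<le> \<eta>\<^sup>2 * (real \<tau> * (norm (G t))\<^sup>2 + (\<Sum>s=t-\<tau>..<t. (norm (G s))\<^sup>2))"
    by (rule mult_left_mono) simp
  then show ?thesis by (simp add: power2_eq_square mult_ac)
qed

lemma delayed_distance_bound:
  fixes G :: "nat \<Rightarrow> 'a :: real_normed_vector"
  assumes "t - \<tau> \<le> k" "k \<le> t"
  shows "(norm (- (\<eta> *\<^sub>R (\<Sum>s=k..<t. G s))))\<^sup>2 \<le> \<eta>\<^sup>2 * (real \<tau> * (\<Sum>s=t-\<tau>..<t. (norm (G s))\<^sup>2))"
proof -
  have "(norm (\<Sum>s=k..<t. G s))\<^sup>2 \<le> real (t - k) * (\<Sum>s=k..<t. (norm (G s))\<^sup>2)"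
    using norm_sum_power2_le[of G "{k..<t}"] by simp
  also have "\<dots> \<le> real \<tau> * (\<Sum>s=t-\<tau>..<t. (norm (G s))\<^sup>2)"
    using assms by (intro mult_mono sum_mono2 sum_nonneg) auto
  finally show ?thesis by (simp add: power_mult_distrib mult_left_mono)
qed

section \<open>Random variables with finitely many values\<close>

lemma (in prob_space) integrable_simple:
  fixes g :: "'a \<Rightarrow> real"
  assumes "simple_function M g"
  shows "integrable M g"
proof (rule integrable_const_bound[where B = "Max (norm ` g ` space M)"])
  have "finite (norm ` g ` space M)" using assms by (simp add: simple_function_def)
  then show "AE \<omega> in M. norm (g \<omega>) \<le> Max (norm ` g ` space M)"
    by (intro AE_I2 Max_ge) auto
qed (rule borel_measurable_simple_function[OF assms])

lemma simple_function_PiM_component: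
  assumes "sets M = sets (PiM UNIV (\<lambda>_. count_space A))" "finite A"
  shows "simple_function M (\<lambda>\<omega>. \<omega> t)"
proof -
  have sp: "space M = UNIV \<rightarrow>\<^sub>E A"
    using sets_eq_imp_space_eq[OF assms(1)] by (simp add: space_PiM)
  have "(\<lambda>\<omega>. \<omega> t) \<in> measurable (PiM UNIV (\<lambda>_. count_space A)) (count_space A)"
    by (rule measurable_component_singleton) simp
  then have meas: "(\<lambda>\<omega>. \<omega> t) \<in> measurable M (count_space A)"
    using measurable_cong_sets[OF assms(1) refl] by blast
  have im: "(\<lambda>\<omega>. \<omega> t) ` space M \<subseteq> A" by (auto simp: sp)
  show ?thesis
    unfolding simple_function_def
  proof safe
    show "finite ((\<lambda>\<omega>. \<omega> t) ` space M)" using im assms(2) by (rule finite_subset)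
    show "(\<lambda>\<omega>. \<omega> t) -` {\<omega> t} \<inter> space M \<in> sets M" if "\<omega> \<in> space M" for \<omega>
      using that im by (intro measurable_sets[OF meas]) auto
  qed
qed

text \<open>A finite form of conditioning on \<open>X\<close>: the space is cut into joint level
  sets of \<open>X\<close> and \<open>I\<close>, on which the integrand is constant, and
  independence gives each of them the probability of the level set of \<open>X\<close> divided by
  \<open>n\<close>. Singletons of a T1 space are closed, so independence applies to level
  sets.\<close>

lemma (in prob_space) expectation_indep_uniform:
  fixes X :: "'a \<Rightarrow> 'b :: t1_space" and \<phi> :: "'b \<Rightarrow> nat \<Rightarrow> real"
  assumes X: "simple_function M X" and I: "simple_function M I"
    and indep: "indep_rvs M borel X (count_space {1..n}) I"
    and unif: "distr M (count_space {1..n}) I = uniform_count_measure {1..n}"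
  shows "expectation (\<lambda>\<omega>. \<phi> (X \<omega>) (I \<omega>)) = expectation (\<lambda>\<omega>. 1 / real n * (\<Sum>i=1..n. \<phi> (X \<omega>) i))"
proof -
  define A where "A v = X -` {v} \<inter> space M" for v
  define B where "B i = I -` {i} \<inter> space M" for i
  define R where "R = X ` space M"
  have finR: "finite R" using X by (simp add: R_def simple_function_def)
  have mI: "I \<in> measurable M (count_space {1..n})" and mX: "X \<in> measurable M borel"
    using indep by (auto simp: indep_rvs_def)
  have A: "A v \<in> events" for v unfolding A_def by (rule measurable_sets[OF mX]) simp
  have B: "B i \<in> events" if "i \<in> {1..n}" for i
    unfolding B_def by (rule measurable_sets[OF mI]) (use that in auto)
  have pB: "prob (B i) = 1 / real n" if "i \<in> {1..n}" for i
  proof -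
    have "prob (B i) = measure (distr M (count_space {1..n}) I) {i}"
      unfolding B_def using that by (subst measure_distr[OF mI]) auto
    also have "\<dots> = 1 / real n"
      unfolding unif using that by (simp add: measure_uniform_count_measure)
    finally show ?thesis .
  qed
  have pAB: "prob (A v \<inter> B i) = prob (A v) / real n" if "i \<in> {1..n}" for v i
  proof -
    have "A v \<in> {X -` S \<inter> space M |S. S \<in> sets borel}"
      by (auto simp: A_def intro!: exI[of _ "{v}"])
    moreover have "B i \<in> {I -` S \<inter> space M |S. S \<in> sets (count_space {1..n})}"
      unfolding B_def using that by (intro CollectI exI[of _ "{i}"]) auto
    ultimately have "prob (A v \<inter> B i) = prob (A v) * prob (B i)"
      using indep by (auto simp: indep_rvs_def intro: indep_setD)
    then show ?thesis by (simp add: pB[OF that])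
  qed
  have int: "integrable M (\<lambda>\<omega>. \<phi> v i * indicator (A v \<inter> B i) \<omega>)" if "i \<in> {1..n}" for v i
    by (intro integrable_mult_right integrable_real_indicator sets.Int A B[OF that])
      (simp add: less_top[symmetric])
  have "expectation (\<lambda>\<omega>. \<phi> (X \<omega>) (I \<omega>))
      = expectation (\<lambda>\<omega>. \<Sum>v\<in>R. \<Sum>i=1..n. \<phi> v i * indicator (A v \<inter> B i) \<omega>)"
  proof (rule Bochner_Integration.integral_cong[OF refl])
    fix \<omega> assume \<omega>: "\<omega> \<in> space M"
    have i: "I \<omega> \<in> {1..n}" using measurable_space[OF mI \<omega>] by simp
    have "(\<Sum>v\<in>R. \<Sum>i=1..n. \<phi> v i * indicator (A v \<inter> B i) \<omega>)
        = (\<Sum>v\<in>R. \<Sum>i=1..n. if v = X \<omega> then (if i = I \<omega> then \<phi> v i else 0) else 0)"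
      by (intro sum.cong refl) (use \<omega> in \<open>auto simp: A_def B_def indicator_def\<close>)
    also have "\<dots> = (\<Sum>v\<in>R. if v = X \<omega> then \<phi> v (I \<omega>) else 0)"
      using i by (intro sum.cong refl) auto
    also have "\<dots> = \<phi> (X \<omega>) (I \<omega>)"
      using \<omega> finR by (simp add: R_def)
    finally show "\<phi> (X \<omega>) (I \<omega>) = (\<Sum>v\<in>R. \<Sum>i=1..n. \<phi> v i * indicator (A v \<inter> B i) \<omega>)" ..
  qed
  also have "\<dots> = (\<Sum>v\<in>R. expectation (\<lambda>\<omega>. \<Sum>i=1..n. \<phi> v i * indicator (A v \<inter> B i) \<omega>))"
    by (intro Bochner_Integration.integral_sum Bochner_Integration.integrable_sum int)
  also have "\<dots> = (\<Sum>v\<in>R. \<Sum>i=1..n. expectation (\<lambda>\<omega>. \<phi> v i * indicator (A v \<inter> B i) \<omega>))"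
    by (intro sum.cong refl Bochner_Integration.integral_sum int)
  also have "\<dots> = (\<Sum>v\<in>R. \<Sum>i=1..n. \<phi> v i * prob (A v \<inter> B i))"
    by (intro sum.cong refl) (use A B in \<open>simp add: sets.Int\<close>)
  also have "\<dots> = (\<Sum>v\<in>R. 1 / real n * (\<Sum>i=1..n. \<phi> v i) * prob (A v))"
    by (simp add: pAB sum_distrib_left sum_distrib_right mult_ac)
  also have "\<dots> = expectation (\<lambda>\<omega>. \<Sum>v\<in>R. 1 / real n * (\<Sum>i=1..n. \<phi> v i) * indicator (A v) \<omega>)"
  proof (subst Bochner_Integration.integral_sum)
    show "integrable M (\<lambda>\<omega>. 1 / real n * (\<Sum>i=1..n. \<phi> v i) * indicator (A v) \<omega>)" for v
      by (intro integrable_mult_right integrable_real_indicator A) (simp add: less_top[symmetric])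
  qed (use A in simp)
  also have "\<dots> = expectation (\<lambda>\<omega>. 1 / real n * (\<Sum>i=1..n. \<phi> (X \<omega>) i))"
  proof (rule Bochner_Integration.integral_cong[OF refl])
    fix \<omega> assume \<omega>: "\<omega> \<in> space M"
    have "(\<Sum>v\<in>R. 1 / real n * (\<Sum>i=1..n. \<phi> v i) * indicator (A v) \<omega>)
        = (\<Sum>v\<in>R. if v = X \<omega> then 1 / real n * (\<Sum>i=1..n. \<phi> v i) else 0)"
      by (intro sum.cong refl) (use \<omega> in \<open>auto simp: A_def indicator_def\<close>)
    also have "\<dots> = 1 / real n * (\<Sum>i=1..n. \<phi> (X \<omega>) i)"
      using \<omega> finR by (simp add: R_def)
    finally show "(\<Sum>v\<in>R. 1 / real n * (\<Sum>i=1..n. \<phi> v i) * indicator (A v) \<omega>)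
        = 1 / real n * (\<Sum>i=1..n. \<phi> (X \<omega>) i)" .
  qed
  finally show ?thesis .
qed

section \<open>The iterates of DAP-SGD\<close>

locale composite_problem =
  fixes m n :: nat and f :: "nat \<Rightarrow> fvec \<Rightarrow> real" and h :: "fvec \<Rightarrow> real"
    and \<mu> L Cf Ch :: real and xstar :: fvec
  assumes n: "n \<ge> 1" and \<mu>: "\<mu> > 0"
    and diff: "\<And>i. i \<in> {1..n} \<Longrightarrow> f i differentiable_on Rdim m"
    and strong: "strongly_convex m \<mu> (average n f)"
    and convex: "convex_on (Rdim m) h"
    and lipschitz: "L-lipschitz_on (Rdim m) (gradient m (average n f))"
    and variance_le: "\<And>x. x \<in> Rdim m \<Longrightarrow>
      1 / real n * (\<Sum>i=1..n. (norm (gradient m (f i) x - gradient m (average n f) x))\<^sup>2) \<le> Cf"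
    and subgradient_le: "\<And>x g. x \<in> Rdim m \<Longrightarrow> g \<in> subdifferential m h x \<Longrightarrow> (norm g)\<^sup>2 \<le> Ch"
    and minimizer: "is_arg_min (\<lambda>x. average n f x + h x) (\<lambda>x. x \<in> Rdim m) xstar"
begin

abbreviation grad :: "fvec \<Rightarrow> fvec"
  where "grad \<equiv> gradient m (average n f)"

lemma xstar_Rdim: "xstar \<in> Rdim m"
  using minimizer by (simp add: is_arg_min_def)

lemma gradient_component_Rdim: "i \<in> {1..n} \<Longrightarrow> x \<in> Rdim m \<Longrightarrow> gradient m (f i) x \<in> Rdim m"
  using diff by (auto simp: differentiable_on_def intro: gradient_in_Rdim)

lemma grad_Rdim: "x \<in> Rdim m \<Longrightarrow> grad x \<in> Rdim m"
  using gradient_average[OF diff]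
  by (auto intro!: subspace_scale subspace_sum subspace_Rdim gradient_component_Rdim)

lemma subgradient_xstar: "- grad xstar \<in> subdifferential m h xstar"
  using strong \<mu> convex lipschitz minimizer grad_Rdim[OF xstar_Rdim]
  by (rule minus_gradient_in_subdifferential)

text \<open>Defined before a run is fixed, hence independent of the horizon, the delays and the law
  of the indices. \<open>A\<close> will bound the last error plus the accumulated decrease,
  \<open>A / (c * \<mu>)\<close> the sum of the delayed errors over the square root of the horizon,
  and \<open>2 * B\<close> the cost of passing from delayed to current errors.\<close>

definition rate_const :: "fvec \<Rightarrow> nat \<Rightarrow> real \<Rightarrow> real"
  where "rate_const x0 \<tau> c =
    (let K = 3 * (Cf + 4 * Ch);
         A = (norm (x0 - xstar))\<^sup>2 + c\<^sup>2 * (4 * Ch + 2 * (1 + real \<tau>) * K);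
         B = c\<^sup>2 * (real \<tau>)\<^sup>2 * (3 * L\<^sup>2 * (A / (c * \<mu>)) + K)
     in 2 * (A / (c * \<mu>)) + 2 * B + A)"

lemma mean_noise_eq_0:
  assumes "x \<in> Rdim m"
  shows "(\<Sum>i=1..n. gradient m (f i) x - grad x) = 0"
proof -
  have "real n *\<^sub>R grad x = (\<Sum>i=1..n. gradient m (f i) x)"
    using gradient_average[OF diff assms] n by simp
  then show ?thesis by (simp add: sum_subtractf sum_constant_scaleR del: sum_constant)
qed

end

section \<open>A single run with constant step size\<close>

locale dap_sgd_run = composite_problem + prob_space M
  for M :: "(nat \<Rightarrow> nat) measure" +
  fixes \<eta> :: real and d :: "nat \<Rightarrow> nat" and x0 :: fvec and T \<tau> :: nat
    and x :: "nat \<Rightarrow> (nat \<Rightarrow> nat) \<Rightarrow> fvec"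
  assumes \<eta>: "\<eta> > 0" and x0: "x0 \<in> Rdim m" and delay: "delay_seq \<tau> d"
    and run: "dap_sgd m n f h (\<lambda>_. \<eta>) d x0 T M x"
begin

text \<open>Read off from the increment rather than from a chosen proximal point, so that
  \<open>x_Suc\<close> and \<open>x_delay\<close> hold for every \<open>t\<close> and \<omega>, also
  beyond the horizon.\<close>

definition G :: "nat \<Rightarrow> (nat \<Rightarrow> nat) \<Rightarrow> fvec"
  where "G t \<omega> = (1 / \<eta>) *\<^sub>R (x t \<omega> - x (Suc t) \<omega>)"

definition noise :: "nat \<Rightarrow> (nat \<Rightarrow> nat) \<Rightarrow> fvec"
  where "noise t \<omega> = gradient m (f (\<omega> t)) (x (d t) \<omega>) - grad (x (d t) \<omega>)"

lemma d_le: "d t \<le> t" "t - \<tau> \<le> d t"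
  using delay by (auto simp: delay_seq_def)

lemma sets_M: "sets M = sets (PiM UNIV (\<lambda>_. count_space {1..n}))"
  using run by (simp add: dap_sgd_def)

lemma index_range: "\<omega> \<in> space M \<Longrightarrow> \<omega> t \<in> {1..n}"
  using sets_eq_imp_space_eq[OF sets_M] by (auto simp: space_PiM)

lemma x_Suc: "x (Suc t) \<omega> = x t \<omega> - \<eta> *\<^sub>R G t \<omega>"
  using \<eta> by (simp add: G_def)

lemma x_delay: "x t \<omega> = x (d t) \<omega> + - (\<eta> *\<^sub>R (\<Sum>s=d t..<t. G s \<omega>))"
proof -
  have "- (\<eta> *\<^sub>R (\<Sum>s=d t..<t. G s \<omega>)) = (\<Sum>s=d t..<t. x (Suc s) \<omega> - x s \<omega>)"
    by (simp add: x_Suc scaleR_sum_right sum_negf)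
  also have "\<dots> = x t \<omega> - x (d t) \<omega>"
    using d_le(1) by (rule sum_Suc_diff')
  finally show ?thesis by simp
qed

text \<open>The update adds \<open>x' - x (d t) \<omega>\<close> to the current iterate; therefore
  subtracting the same vector \<open>\<eta> *\<^sub>R G t \<omega>\<close> from the delayed iterate
  yields its proximal point.\<close>

lemma prox_step:
  assumes "t < T" "\<omega> \<in> space M"
  shows "x (d t) \<omega> - \<eta> *\<^sub>R G t \<omega>
    \<in> Prox m \<eta> h (x (d t) \<omega> - \<eta> *\<^sub>R gradient m (f (\<omega> t)) (x (d t) \<omega>))"
proof -
  obtain x' where x': "x' \<in> Prox m \<eta> h (x (d t) \<omega> - \<eta> *\<^sub>R gradient m (f (\<omega> t)) (x (d t) \<omega>))"
    "x (Suc t) \<omega> = x t \<omega> + x' - x (d t) \<omega>"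
    using run assms unfolding dap_sgd_def by blast
  have "x (d t) \<omega> - \<eta> *\<^sub>R G t \<omega> = x'"
    using x'(2) by (simp add: x_Suc algebra_simps)
  with x'(1) show ?thesis by simp
qed

text \<open>Each new iterate is a combination of two earlier iterates and a proximal point. The
  delayed one may lie further back, hence the strong induction.\<close>

lemma x_Rdim:
  assumes "\<omega> \<in> space M"
  shows "t \<le> T \<Longrightarrow> x t \<omega> \<in> Rdim m"
proof (induction t rule: less_induct)
  case (less t)
  show ?case
  proof (cases t)
    case 0
    then show ?thesis using run assms x0 by (simp add: dap_sgd_def)
  next
    case (Suc s)
    have "x (d s) \<omega> - \<eta> *\<^sub>R G s \<omega> \<in> Rdim m"
      using prox_step[of s \<omega>] assms less.prems Suc by (simp add: Prox_def is_arg_min_def)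
    moreover have "x s \<omega> \<in> Rdim m" "x (d s) \<omega> \<in> Rdim m"
      using less Suc d_le[of s] by auto
    moreover have "x t \<omega> = x s \<omega> + (x (d s) \<omega> - \<eta> *\<^sub>R G s \<omega>) - x (d s) \<omega>"
      by (simp add: Suc x_Suc)
    ultimately show ?thesis
      by (metis subspace_add subspace_diff subspace_Rdim)
  qed
qed

lemma x_delay_Rdim: "\<omega> \<in> space M \<Longrightarrow> t \<le> T \<Longrightarrow> x (d t) \<omega> \<in> Rdim m"
  using x_Rdim d_le[of t] by auto

section \<open>Finitely valued iterates and averages over the sample index\<close>

lemma simple_index: "simple_function M (\<lambda>\<omega>. \<omega> t)"
  using sets_M by (rule simple_function_PiM_component) simp

text \<open>Since the proximal point is unique, each iterate is a function of finitely many sample indices.\<close>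

lemma simple_x: "t \<le> T \<Longrightarrow> simple_function M (x t)"
proof (induction t rule: less_induct)
  case (less t)
  show ?case
  proof (cases t)
    case 0
    have "simple_function M (\<lambda>_. x0)" by simp
    then show ?thesis
      using run 0 by (subst simple_function_cong[of M _ "\<lambda>_. x0"]) (auto simp: dap_sgd_def)
  next
    case (Suc s)
    \<comment> \<open>\<open>Prox\<close> is a set; the definite description makes the update a
      function of the delayed iterate and the index, so that simple functions can be
      composed.\<close>
    define \<Phi> where "\<Phi> v i = (THE x'. x' \<in> Prox m \<eta> h (v - \<eta> *\<^sub>R gradient m (f i) v))" for v i
    have *: "x t \<omega> = x s \<omega> + (\<Phi> (x (d s) \<omega>) (\<omega> s) - x (d s) \<omega>)" if \<omega>: "\<omega> \<in> space M" for \<omega>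
    proof -
      have "x (d s) \<omega> \<in> Rdim m" using x_delay_Rdim[OF \<omega>, of s] less.prems Suc by simp
      then have "x (d s) \<omega> - \<eta> *\<^sub>R gradient m (f (\<omega> s)) (x (d s) \<omega>) \<in> Rdim m"
        using gradient_component_Rdim[OF index_range[OF \<omega>]]
        by (auto intro: subspace_diff subspace_scale subspace_Rdim)
      then have "\<Phi> (x (d s) \<omega>) (\<omega> s) = x (d s) \<omega> - \<eta> *\<^sub>R G s \<omega>"
        unfolding \<Phi>_def using prox_step[of s \<omega>] \<omega> less.prems Suc
        by (intro the_equality Prox_unique[OF convex \<eta>]) auto
      then show ?thesis by (simp add: Suc x_Suc)
    qed
    have "simple_function M (x s)" "simple_function M (x (d s))"
      using less Suc d_le[of s] by auto
    then have "simple_function M (\<lambda>\<omega>. x s \<omega> + (\<Phi> (x (d s) \<omega>) (\<omega> s) - x (d s) \<omega>))"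
      by (intro simple_function_compose2[where h = "\<lambda>a b. a + b"]
          simple_function_compose2[where h = "\<lambda>a b. a - b"]
          simple_function_compose2[where h = \<Phi>] simple_index)
    then show ?thesis
      using * by (subst simple_function_cong) auto
  qed
qed

lemma simple_x_delay: "t \<le> T \<Longrightarrow> simple_function M (x (d t))"
  using simple_x d_le[of t] by auto

lemma simple_G: "t < T \<Longrightarrow> simple_function M (G t)"
  using simple_function_compose2[where h = "\<lambda>a b. (1 / \<eta>) *\<^sub>R (a - b)",
      OF simple_x[of t] simple_x[of "Suc t"]]
  by (simp add: G_def[abs_def])

lemma simple_noise: "t < T \<Longrightarrow> simple_function M (noise t)"
  using simple_function_compose2[where h = "\<lambda>a i. gradient m (f i) a - grad a",
      OF simple_x_delay[of t] simple_index[of t]]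
  by (simp add: noise_def[abs_def])

lemma integrable_x: "t \<le> T \<Longrightarrow> integrable M (\<lambda>\<omega>. (norm (x t \<omega> - xstar))\<^sup>2)"
  using simple_function_compose1[OF simple_x] by (rule integrable_simple)

lemma integrable_x_delay: "t \<le> T \<Longrightarrow> integrable M (\<lambda>\<omega>. (norm (x (d t) \<omega> - xstar))\<^sup>2)"
  using integrable_x d_le[of t] by simp

lemma integrable_G: "t < T \<Longrightarrow> integrable M (\<lambda>\<omega>. (norm (G t \<omega>))\<^sup>2)"
  using simple_function_compose1[OF simple_G] by (rule integrable_simple)

lemma integrable_noise: "t < T \<Longrightarrow> integrable M (\<lambda>\<omega>. (norm (noise t \<omega>))\<^sup>2)"
  using simple_function_compose1[OF simple_noise] by (rule integrable_simple)

lemma integrable_noise_inner: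
  "t < T \<Longrightarrow> integrable M (\<lambda>\<omega>. inner (noise t \<omega>) (x (d t) \<omega> - xstar))"
  using simple_function_compose2[OF simple_noise simple_x_delay,
      where h = "\<lambda>a b. inner a (b - xstar)"] by (intro integrable_simple) auto

text \<open>The only point at which uniformity and independence of the indices enter. The integrand
  may depend on the delayed iterate and the index alone.\<close>

lemma expectation_index:
  fixes \<phi> :: "fvec \<Rightarrow> nat \<Rightarrow> real"
  assumes "t < T"
  shows "expectation (\<lambda>\<omega>. \<phi> (x (d t) \<omega>) (\<omega> t))
    = expectation (\<lambda>\<omega>. 1 / real n * (\<Sum>i=1..n. \<phi> (x (d t) \<omega>) i))"
  using run assms simple_x_delay[of t]
  by (intro expectation_indep_uniform simple_index) (auto simp: dap_sgd_def)

text \<open>Unbiasedness, paired with the delayed error. The current error would not do, since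
  nothing is assumed about its dependence on the index.\<close>

lemma expectation_noise_inner:
  assumes "t < T"
  shows "expectation (\<lambda>\<omega>. inner (noise t \<omega>) (x (d t) \<omega> - xstar)) = 0"
proof -
  have "expectation (\<lambda>\<omega>. inner (noise t \<omega>) (x (d t) \<omega> - xstar)) = expectation (\<lambda>\<omega>. 1 / real n *
      (\<Sum>i=1..n. inner (gradient m (f i) (x (d t) \<omega>) - grad (x (d t) \<omega>)) (x (d t) \<omega> - xstar)))"
    unfolding noise_def
    using expectation_index[OF assms, of "\<lambda>v i. inner (gradient m (f i) v - grad v) (v - xstar)"] .
  also have "\<dots> = expectation (\<lambda>_. 0)"
  proof (rule Bochner_Integration.integral_cong[OF refl])
    fix \<omega> assume "\<omega> \<in> space M"
    then have "x (d t) \<omega> \<in> Rdim m" using assms by (simp add: x_delay_Rdim)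
    then show "1 / real n * (\<Sum>i=1..n. inner (gradient m (f i) (x (d t) \<omega>) - grad (x (d t) \<omega>))
        (x (d t) \<omega> - xstar)) = 0"
      unfolding inner_sum_left[symmetric] by (simp only: mean_noise_eq_0) simp
  qed
  finally show ?thesis by simp
qed

lemma expectation_noise_power2:
  assumes "t < T"
  shows "expectation (\<lambda>\<omega>. (norm (noise t \<omega>))\<^sup>2) \<le> Cf"
proof -
  have "expectation (\<lambda>\<omega>. (norm (noise t \<omega>))\<^sup>2) = expectation (\<lambda>\<omega>. 1 / real n *
      (\<Sum>i=1..n. (norm (gradient m (f i) (x (d t) \<omega>) - grad (x (d t) \<omega>)))\<^sup>2))"
    unfolding noise_def
    using expectation_index[OF assms, of "\<lambda>v i. (norm (gradient m (f i) v - grad v))\<^sup>2"] .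
  also have "\<dots> \<le> expectation (\<lambda>_. Cf)"
  proof (rule integral_mono)
    show "integrable M (\<lambda>\<omega>. 1 / real n *
        (\<Sum>i=1..n. (norm (gradient m (f i) (x (d t) \<omega>) - grad (x (d t) \<omega>)))\<^sup>2))"
      using assms by (intro integrable_simple simple_function_compose1[OF simple_x_delay]) simp
  qed (use assms variance_le x_delay_Rdim in auto)
  finally show ?thesis by (simp add: prob_space)
qed

section \<open>Bounds along a single realisation\<close>

lemma subgradient_part:
  assumes "t < T" "\<omega> \<in> space M"
  defines "u \<equiv> G t \<omega> - (grad (x (d t) \<omega>) - grad xstar) - noise t \<omega>"
  shows "inner u (x (d t) \<omega> - xstar - \<eta> *\<^sub>R G t \<omega>) \<ge> 0" and "(norm u)\<^sup>2 \<le> 4 * Ch"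
proof -
  define v where "v = x (d t) \<omega>"
  define y where "y = v - \<eta> *\<^sub>R G t \<omega>"
  define g where "g = gradient m (f (\<omega> t)) v"
  have v: "v \<in> Rdim m" using assms by (simp add: v_def x_delay_Rdim)
  have yP: "y \<in> Prox m \<eta> h (v - \<eta> *\<^sub>R g)"
    using prox_step[OF assms(1,2)] by (simp add: y_def g_def v_def)
  then have yR: "y \<in> Rdim m" by (simp add: Prox_def is_arg_min_def)
  have "v - \<eta> *\<^sub>R g \<in> Rdim m"
    unfolding g_def by (intro subspace_diff subspace_scale subspace_Rdim v
        gradient_component_Rdim index_range assms)
  from subdifferential_Prox[OF convex \<eta> this yP]
  have "(1 / \<eta>) *\<^sub>R (v - \<eta> *\<^sub>R g - y) \<in> subdifferential m h y" .
  also have "(1 / \<eta>) *\<^sub>R (v - \<eta> *\<^sub>R g - y) = G t \<omega> - g"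
    using \<eta> by (simp add: y_def scaleR_diff_right)
  finally have sub: "G t \<omega> - g \<in> subdifferential m h y" .
  \<comment> \<open>So \<open>u\<close> is a subgradient of \<open>h\<close> at the proximal point
    minus the subgradient \<open>- grad xstar\<close> at the minimizer. Monotonicity gives the sign,
    and the bound \<open>Ch\<close> on each subgradient gives the size.\<close>
  have u: "u = (G t \<omega> - g) - (- grad xstar)"
    by (simp add: u_def noise_def g_def v_def)
  show "inner u (x (d t) \<omega> - xstar - \<eta> *\<^sub>R G t \<omega>) \<ge> 0"
    using subdifferential_monotone[OF sub subgradient_xstar yR xstar_Rdim]
    by (simp add: u y_def v_def algebra_simps)
  have "(norm u)\<^sup>2 \<le> 2 * ((norm (G t \<omega> - g))\<^sup>2 + (norm (grad xstar))\<^sup>2)"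
    using zero_le_power2[of "norm ((G t \<omega> - g) - grad xstar)"] unfolding u power2_norm_eq_inner
    by (simp add: inner_add_left inner_add_right inner_diff_left inner_diff_right inner_commute)
  also have "\<dots> \<le> 2 * (Ch + Ch)"
    using subgradient_le[OF yR sub] subgradient_le[OF xstar_Rdim subgradient_xstar] by simp
  finally show "(norm u)\<^sup>2 \<le> 4 * Ch" by simp
qed

text \<open>The coefficient \<open>2 + \<tau>\<close> collects 2 from
  \<open>perturbed_step_bound\<close> and \<tau> from the product of the step with the
  drift.\<close>

lemma step_bound:
  assumes "t < T" "\<omega> \<in> space M"
  shows "(norm (x (Suc t) \<omega> - xstar))\<^sup>2 \<le> (norm (x t \<omega> - xstar))\<^sup>2
    - 2 * \<eta> * \<mu> * (norm (x (d t) \<omega> - xstar))\<^sup>2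
    - 2 * \<eta> * inner (noise t \<omega>) (x (d t) \<omega> - xstar)
    + \<eta>\<^sup>2 * (4 * Ch + (2 + real \<tau>) * (norm (G t \<omega>))\<^sup>2 + (\<Sum>s=t-\<tau>..<t. (norm (G s \<omega>))\<^sup>2))"
proof -
  define e where "e = x (d t) \<omega> - xstar"
  define r where "r = - (\<eta> *\<^sub>R (\<Sum>s=d t..<t. G s \<omega>))"
  have er: "x t \<omega> - xstar = e + r" by (subst x_delay) (simp add: e_def r_def)
  have step: "(norm (e + r - \<eta> *\<^sub>R G t \<omega>))\<^sup>2 \<le> (norm (e + r))\<^sup>2 - 2 * \<eta> * \<mu> * (norm e)\<^sup>2
      - 2 * \<eta> * inner (noise t \<omega>) e + \<eta>\<^sup>2 * (4 * Ch + 2 * (norm (G t \<omega>))\<^sup>2) - 2 * \<eta> * inner (G t \<omega>) r"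
  proof (rule perturbed_step_bound)
    show "G t \<omega> = (grad (x (d t) \<omega>) - grad xstar) + noise t \<omega>
        + (G t \<omega> - (grad (x (d t) \<omega>) - grad xstar) - noise t \<omega>)" by simp
    show "\<mu> * (norm e)\<^sup>2 \<le> inner (grad (x (d t) \<omega>) - grad xstar) e"
      unfolding e_def using assms
      by (intro strongly_convex_monotone[OF strong] x_delay_Rdim xstar_Rdim) auto
  qed (use subgradient_part[OF assms] \<eta> in \<open>auto simp: e_def\<close>)
  have e_Suc: "x (Suc t) \<omega> - xstar = e + r - \<eta> *\<^sub>R G t \<omega>"
    by (simp add: x_Suc er[symmetric])
  have cross: "- 2 * \<eta> * inner (G t \<omega>) r
      \<le> \<eta>\<^sup>2 * (real \<tau> * (norm (G t \<omega>))\<^sup>2 + (\<Sum>s=t-\<tau>..<t. (norm (G s \<omega>))\<^sup>2))"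
    unfolding r_def using \<eta> d_le by (intro delayed_inner_bound[of _ _ _ _ "\<lambda>s. G s \<omega>"]) auto
  show ?thesis
    unfolding er e_Suc e_def[symmetric] using step cross by (simp add: algebra_simps)
qed

text \<open>The direction is split into gradient difference, noise and subgradient difference, and
  squaring a sum of three costs the factor 3. The gradient part is controlled only through the
  Lipschitz constant, so the delayed error appears in the bound.\<close>

lemma G_bound:
  assumes "t < T" "\<omega> \<in> space M"
  shows "(norm (G t \<omega>))\<^sup>2
    \<le> 3 * L\<^sup>2 * (norm (x (d t) \<omega> - xstar))\<^sup>2 + 3 * (norm (noise t \<omega>))\<^sup>2 + 12 * Ch"
proof -
  define w where "w = grad (x (d t) \<omega>) - grad xstar"
  define u where "u = G t \<omega> - w - noise t \<omega>"
  have three: "(a + b + c)\<^sup>2 \<le> 3 * (a\<^sup>2 + b\<^sup>2 + c\<^sup>2)" for a b c :: real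
    using zero_le_power2[of "a - b"] zero_le_power2[of "b - c"] zero_le_power2[of "a - c"]
    by (simp add: power2_eq_square algebra_simps)
  have "norm w \<le> L * norm (x (d t) \<omega> - xstar)"
    unfolding w_def using assms lipschitz_onD[OF lipschitz x_delay_Rdim xstar_Rdim]
    by (simp add: dist_norm)
  then have w: "(norm w)\<^sup>2 \<le> L\<^sup>2 * (norm (x (d t) \<omega> - xstar))\<^sup>2"
    unfolding power_mult_distrib[symmetric] by (intro power_mono) auto
  have u: "(norm u)\<^sup>2 \<le> 4 * Ch"
    using subgradient_part(2)[OF assms] by (simp add: u_def w_def)
  have "norm (G t \<omega>) = norm (w + noise t \<omega> + u)" by (simp add: u_def)
  also have "\<dots> \<le> norm w + norm (noise t \<omega>) + norm u"
    by (meson norm_triangle_ineq norm_triangle_le add_right_mono order_trans)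
  finally have "(norm (G t \<omega>))\<^sup>2 \<le> (norm w + norm (noise t \<omega>) + norm u)\<^sup>2"
    by (rule power_mono) simp
  also note three
  also have "3 * ((norm w)\<^sup>2 + (norm (noise t \<omega>))\<^sup>2 + (norm u)\<^sup>2)
      \<le> 3 * (L\<^sup>2 * (norm (x (d t) \<omega> - xstar))\<^sup>2 + (norm (noise t \<omega>))\<^sup>2 + 4 * Ch)"
    using w u by simp
  finally show ?thesis by (simp add: algebra_simps)
qed

section \<open>Recursions for the expected squared errors\<close>

definition err :: "nat \<Rightarrow> real"
  where "err t = expectation (\<lambda>\<omega>. (norm (x t \<omega> - xstar))\<^sup>2)"

definition gsq :: "nat \<Rightarrow> real"
  where "gsq t = expectation (\<lambda>\<omega>. (norm (G t \<omega>))\<^sup>2)"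

lemma err_nonneg: "err t \<ge> 0" and gsq_nonneg: "gsq t \<ge> 0"
  by (simp_all add: err_def gsq_def)

lemma err_0: "err 0 = (norm (x0 - xstar))\<^sup>2"
proof -
  have "err 0 = expectation (\<lambda>_. (norm (x0 - xstar))\<^sup>2)"
    unfolding err_def using run
    by (intro Bochner_Integration.integral_cong) (auto simp: dap_sgd_def)
  then show ?thesis by (simp add: prob_space)
qed

text \<open>Expectation of \<open>step_bound\<close>, where the noise term has mean zero. This is
  the shape required by \<open>delayed_recursion_bound\<close> with
  \<open>b t = err (d t)\<close>.\<close>

lemma err_Suc:
  assumes "t < T"
  shows "err (Suc t) \<le> err t - 2 * \<eta> * \<mu> * err (d t)
    + \<eta>\<^sup>2 * (4 * Ch + (2 + real \<tau>) * gsq t + (\<Sum>s=t-\<tau>..<t. gsq s))"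
proof -
  have I: "integrable M (\<lambda>\<omega>. (norm (x t \<omega> - xstar))\<^sup>2)"
    "integrable M (\<lambda>\<omega>. (norm (x (Suc t) \<omega> - xstar))\<^sup>2)"
    "integrable M (\<lambda>\<omega>. (norm (x (d t) \<omega> - xstar))\<^sup>2)"
    "integrable M (\<lambda>\<omega>. inner (noise t \<omega>) (x (d t) \<omega> - xstar))"
    "integrable M (\<lambda>\<omega>. (norm (G t \<omega>))\<^sup>2)"
    using assms by (auto intro: integrable_x integrable_x_delay integrable_noise_inner integrable_G)
  have IS: "\<And>s. s \<in> {t-\<tau>..<t} \<Longrightarrow> integrable M (\<lambda>\<omega>. (norm (G s \<omega>))\<^sup>2)"
    using assms by (auto intro: integrable_G)
  then have IS': "integrable M (\<lambda>\<omega>. \<Sum>s=t-\<tau>..<t. (norm (G s \<omega>))\<^sup>2)"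
    by (rule Bochner_Integration.integrable_sum)
  have "err (Suc t) \<le> expectation (\<lambda>\<omega>. (norm (x t \<omega> - xstar))\<^sup>2
    - 2 * \<eta> * \<mu> * (norm (x (d t) \<omega> - xstar))\<^sup>2
    - 2 * \<eta> * inner (noise t \<omega>) (x (d t) \<omega> - xstar)
    + \<eta>\<^sup>2 * (4 * Ch + (2 + real \<tau>) * (norm (G t \<omega>))\<^sup>2 + (\<Sum>s=t-\<tau>..<t. (norm (G s \<omega>))\<^sup>2)))"
    unfolding err_def using I IS' by (intro integral_mono step_bound assms) auto
  also have "\<dots> = err t - 2 * \<eta> * \<mu> * err (d t)
    - 2 * \<eta> * expectation (\<lambda>\<omega>. inner (noise t \<omega>) (x (d t) \<omega> - xstar))
    + \<eta>\<^sup>2 * (4 * Ch + (2 + real \<tau>) * gsq t + expectation (\<lambda>\<omega>. \<Sum>s=t-\<tau>..<t. (norm (G s \<omega>))\<^sup>2))"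
    unfolding err_def gsq_def using I IS' by (simp add: prob_space)
  also have "expectation (\<lambda>\<omega>. \<Sum>s=t-\<tau>..<t. (norm (G s \<omega>))\<^sup>2) = (\<Sum>s=t-\<tau>..<t. gsq s)"
    unfolding gsq_def using IS by (rule Bochner_Integration.integral_sum)
  finally show ?thesis by (simp add: expectation_noise_inner[OF assms])
qed

lemma gsq_le:
  assumes "t < T"
  shows "gsq t \<le> 3 * L\<^sup>2 * err (d t) + 3 * (Cf + 4 * Ch)"
proof -
  have I: "integrable M (\<lambda>\<omega>. (norm (x (d t) \<omega> - xstar))\<^sup>2)"
    "integrable M (\<lambda>\<omega>. (norm (noise t \<omega>))\<^sup>2)" "integrable M (\<lambda>\<omega>. (norm (G t \<omega>))\<^sup>2)"
    using assms by (auto intro: integrable_x_delay integrable_noise integrable_G)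
  have "gsq t \<le> expectation (\<lambda>\<omega>. 3 * L\<^sup>2 * (norm (x (d t) \<omega> - xstar))\<^sup>2
      + 3 * (norm (noise t \<omega>))\<^sup>2 + 12 * Ch)"
    unfolding gsq_def using I by (intro integral_mono G_bound assms) auto
  also have "\<dots> = 3 * L\<^sup>2 * err (d t) + 3 * expectation (\<lambda>\<omega>. (norm (noise t \<omega>))\<^sup>2) + 12 * Ch"
    unfolding err_def using I by (simp add: prob_space)
  finally show ?thesis using expectation_noise_power2[OF assms] by simp
qed

text \<open>The recursion controls errors at delayed indices, whereas the running average involves
  the current ones; the passage costs the squared drift.\<close>

lemma err_le_delayed:
  assumes "t < T"
  shows "err t \<le> 2 * err (d t) + 2 * \<eta>\<^sup>2 * real \<tau> * (\<Sum>s=t-\<tau>..<t. gsq s)"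
proof -
  have IS: "\<And>s. s \<in> {t-\<tau>..<t} \<Longrightarrow> integrable M (\<lambda>\<omega>. (norm (G s \<omega>))\<^sup>2)"
    using assms by (auto intro: integrable_G)
  then have IS': "integrable M (\<lambda>\<omega>. \<Sum>s=t-\<tau>..<t. (norm (G s \<omega>))\<^sup>2)"
    by (rule Bochner_Integration.integrable_sum)
  have I: "integrable M (\<lambda>\<omega>. (norm (x t \<omega> - xstar))\<^sup>2)"
    "integrable M (\<lambda>\<omega>. (norm (x (d t) \<omega> - xstar))\<^sup>2)"
    using assms by (auto intro: integrable_x integrable_x_delay)
  have "(norm (x t \<omega> - xstar))\<^sup>2 \<le> 2 * (norm (x (d t) \<omega> - xstar))\<^sup>2
      + 2 * \<eta>\<^sup>2 * real \<tau> * (\<Sum>s=t-\<tau>..<t. (norm (G s \<omega>))\<^sup>2)" for \<omega>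
  proof -
    define e where "e = x (d t) \<omega> - xstar"
    define r where "r = - (\<eta> *\<^sub>R (\<Sum>s=d t..<t. G s \<omega>))"
    have er: "x t \<omega> - xstar = e + r" by (subst x_delay) (simp add: e_def r_def)
    have "(norm (e + r))\<^sup>2 \<le> 2 * (norm e)\<^sup>2 + 2 * (norm r)\<^sup>2"
      using zero_le_power2[of "norm (e - r)"] unfolding power2_norm_eq_inner
      by (simp add: inner_add_left inner_add_right inner_diff_left inner_diff_right inner_commute)
    also have "(norm r)\<^sup>2 \<le> \<eta>\<^sup>2 * (real \<tau> * (\<Sum>s=t-\<tau>..<t. (norm (G s \<omega>))\<^sup>2))"
      unfolding r_def using d_le by (intro delayed_distance_bound) auto
    finally show ?thesis by (simp add: er e_def mult_ac)
  qed
  then have "err t \<le> expectation (\<lambda>\<omega>. 2 * (norm (x (d t) \<omega> - xstar))\<^sup>2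
      + 2 * \<eta>\<^sup>2 * real \<tau> * (\<Sum>s=t-\<tau>..<t. (norm (G s \<omega>))\<^sup>2))"
    unfolding err_def using I IS' by (intro integral_mono) auto
  also have "\<dots> = 2 * err (d t) + 2 * \<eta>\<^sup>2 * real \<tau> * expectation (\<lambda>\<omega>. \<Sum>s=t-\<tau>..<t. (norm (G s \<omega>))\<^sup>2)"
    unfolding err_def using I IS' by simp
  also have "expectation (\<lambda>\<omega>. \<Sum>s=t-\<tau>..<t. (norm (G s \<omega>))\<^sup>2) = (\<Sum>s=t-\<tau>..<t. gsq s)"
    unfolding gsq_def using IS by (rule Bochner_Integration.integral_sum)
  finally show ?thesis .
qed

section \<open>The running average and its rate\<close>

lemma sum_err_le:
  "(\<Sum>t<T. err t) \<le> 2 * (\<Sum>t<T. err (d t)) + 2 * \<eta>\<^sup>2 * (real \<tau>)\<^sup>2 * (\<Sum>t<T. gsq t)"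
proof -
  have "(\<Sum>t<T. err t) \<le> (\<Sum>t<T. 2 * err (d t) + 2 * \<eta>\<^sup>2 * real \<tau> * (\<Sum>s=t-\<tau>..<t. gsq s))"
    by (intro sum_mono err_le_delayed) simp
  also have "\<dots> = 2 * (\<Sum>t<T. err (d t)) + 2 * \<eta>\<^sup>2 * real \<tau> * (\<Sum>t<T. \<Sum>s=t-\<tau>..<t. gsq s)"
    by (simp only: sum.distrib sum_distrib_left)
  \<comment> \<open>One factor \<tau> stems from Cauchy-Schwarz over the drift, the second from
    counting the windows that contain a given index.\<close>
  also have "\<dots> \<le> 2 * (\<Sum>t<T. err (d t)) + 2 * \<eta>\<^sup>2 * real \<tau> * (real \<tau> * (\<Sum>t<T. gsq t))"
    using gsq_nonneg by (intro add_left_mono mult_left_mono sum_window_le) auto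
  finally show ?thesis by (simp add: power2_eq_square mult_ac)
qed

lemma running_average_err:
  shows integrable_running_average: "integrable M (\<lambda>\<omega>. (norm (running_average T x \<omega> - xstar))\<^sup>2)"
    and "expectation (\<lambda>\<omega>. (norm (running_average T x \<omega> - xstar))\<^sup>2)
      \<le> (\<Sum>t=0..T. err t) / real (T + 1)"
proof -
  \<comment> \<open>Written as a mean of \<open>T + 1\<close> deviations, the average falls under
    Jensen's inequality for the squared norm, here in the form of
    \<open>norm_sum_power2_le\<close>.\<close>
  have dev: "running_average T x \<omega> - xstar = (1 / real (T + 1)) *\<^sub>R (\<Sum>t=0..T. x t \<omega> - xstar)" for \<omega>
    by (simp add: running_average_def sum_subtractf sum_constant_scaleR scaleR_diff_right
        del: of_nat_Suc sum_constant)
  have "simple_function M (\<lambda>\<omega>. \<Sum>t\<in>{..<k}. x t \<omega>)" if "k \<le> Suc T" for k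
    using that
  proof (induction k)
    case (Suc k)
    then show ?case
      using simple_function_compose2[where h = "\<lambda>a b. a + b", OF Suc.IH simple_x[of k]] by simp
  qed simp
  from simple_function_compose1[OF this[of "Suc T"],
      where g = "\<lambda>a. (norm ((1 / real (T + 1)) *\<^sub>R a - xstar))\<^sup>2"]
  have "simple_function M (\<lambda>\<omega>. (norm (running_average T x \<omega> - xstar))\<^sup>2)"
    by (simp add: running_average_def atLeast0AtMost lessThan_Suc_atMost del: sum.lessThan_Suc)
  then show int: "integrable M (\<lambda>\<omega>. (norm (running_average T x \<omega> - xstar))\<^sup>2)"
    by (rule integrable_simple)
  have intx: "\<And>t. t \<in> {0..T} \<Longrightarrow> integrable M (\<lambda>\<omega>. (norm (x t \<omega> - xstar))\<^sup>2)"
    by (simp add: integrable_x)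
  have "(norm (running_average T x \<omega> - xstar))\<^sup>2
      \<le> 1 / real (T + 1) * (\<Sum>t=0..T. (norm (x t \<omega> - xstar))\<^sup>2)" for \<omega>
  proof -
    have "(norm (running_average T x \<omega> - xstar))\<^sup>2
        = (1 / real (T + 1))\<^sup>2 * (norm (\<Sum>t=0..T. x t \<omega> - xstar))\<^sup>2"
      unfolding dev by (simp add: power_mult_distrib power_divide)
    also have "\<dots> \<le> (1 / real (T + 1))\<^sup>2 * (real (T + 1) * (\<Sum>t=0..T. (norm (x t \<omega> - xstar))\<^sup>2))"
      using norm_sum_power2_le[of "\<lambda>t. x t \<omega> - xstar" "{0..T}"] by (intro mult_left_mono) auto
    also have "\<dots> = 1 / real (T + 1) * (\<Sum>t=0..T. (norm (x t \<omega> - xstar))\<^sup>2)"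
      by (simp add: power2_eq_square del: of_nat_Suc)
    finally show ?thesis .
  qed
  then have "expectation (\<lambda>\<omega>. (norm (running_average T x \<omega> - xstar))\<^sup>2)
      \<le> expectation (\<lambda>\<omega>. 1 / real (T + 1) * (\<Sum>t=0..T. (norm (x t \<omega> - xstar))\<^sup>2))"
    using int intx
    by (intro integral_mono integrable_mult_right Bochner_Integration.integrable_sum) auto
  also have "\<dots> = 1 / real (T + 1) * (\<Sum>t=0..T. err t)"
  proof -
    have "expectation (\<lambda>\<omega>. \<Sum>t=0..T. (norm (x t \<omega> - xstar))\<^sup>2) = (\<Sum>t=0..T. err t)"
      unfolding err_def using intx by (rule Bochner_Integration.integral_sum)
    then show ?thesis by (simp only: integral_mult_right_zero)
  qed
  finally show "expectation (\<lambda>\<omega>. (norm (running_average T x \<omega> - xstar))\<^sup>2)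
      \<le> (\<Sum>t=0..T. err t) / real (T + 1)"
    by (simp add: mult.commute)
qed

text \<open>The summed recursion bounds \<open>\<eta> * \<mu> * S\<close> by a constant, so
  \<open>S\<close> grows at most like the square root of \<open>T\<close>. The current errors sum to
  the same order, and division by the number of iterates gives the rate.\<close>

lemma convergence_rate:
  assumes T: "T \<ge> 1" and Cf: "Cf \<ge> 0" and Ch: "Ch \<ge> 0"
    and c: "c > 0" "6 * (1 + real \<tau>) * L\<^sup>2 * c = \<mu>" and \<eta>_eq: "\<eta> = c / sqrt (real T)"
  shows "expectation (\<lambda>\<omega>. (norm (running_average T x \<omega> - xstar))\<^sup>2)
    \<le> rate_const x0 \<tau> c / sqrt (real T)"
proof -
  define K where "K = 3 * (Cf + 4 * Ch)"
  define A where "A = (norm (x0 - xstar))\<^sup>2 + c\<^sup>2 * (4 * Ch + 2 * (1 + real \<tau>) * K)"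
  define B where "B = c\<^sup>2 * (real \<tau>)\<^sup>2 * (3 * L\<^sup>2 * (A / (c * \<mu>)) + K)"
  have rate: "rate_const x0 \<tau> c = 2 * (A / (c * \<mu>)) + 2 * B + A"
    by (simp add: rate_const_def Let_def K_def A_def B_def)
  define q where "q = sqrt (real T)"
  define S where "S = (\<Sum>t<T. err (d t))"
  have q: "q \<ge> 1" "q\<^sup>2 = real T" using T by (auto simp: q_def)
  have qq: "q \<le> real T" using q by (metis self_le_power zero_less_numeral)
  have \<eta>q: "\<eta> = c / q" by (simp add: \<eta>_eq q_def)
  \<comment> \<open>This balance turns the total of the errors of order
    \<open>\<eta>\<^sup>2\<close> over \<open>T\<close> steps into a constant.\<close>
  have \<eta>2: "\<eta>\<^sup>2 * real T = c\<^sup>2" using q T by (simp add: \<eta>q power_divide)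
  have K: "K \<ge> 0" using Cf Ch by (simp add: K_def)
  have A: "A \<ge> 0" using K Ch by (simp add: A_def)
  \<comment> \<open>The absorption condition is an equality at \<open>c\<close>, and every step size
    in use is at most \<open>c\<close> because \<open>T \<ge> 1\<close>.\<close>
  have "\<eta> \<le> c" using q c by (simp add: \<eta>q field_simps)
  then have small: "6 * (1 + real \<tau>) * L\<^sup>2 * \<eta> \<le> \<mu>"
    unfolding c(2)[symmetric] by (intro mult_left_mono) auto
  have "err T + \<eta> * \<mu> * S \<le> err 0 + \<eta>\<^sup>2 * real T * (4 * Ch + 2 * (1 + real \<tau>) * K)"
    unfolding S_def K_def using \<eta> small
    by (intro delayed_recursion_bound[where \<gamma> = gsq and L = L] err_Suc gsq_le gsq_nonneg err_nonneg)
  then have main: "err T + \<eta> * \<mu> * S \<le> A" by (simp add: \<eta>2 err_0 A_def)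
  have S0: "S \<ge> 0" by (simp add: S_def sum_nonneg err_nonneg)
  have errT: "err T \<le> A" using main S0 \<eta> \<mu> by (smt (verit) mult_nonneg_nonneg)
  have "c / q * \<mu> * S \<le> A" using main err_nonneg[of T] by (simp add: \<eta>q)
  then have SA: "S \<le> A / (c * \<mu>) * q"
    using q c \<mu> by (simp add: field_simps)
  \<comment> \<open>This cruder bound, linear in \<open>T\<close>, suffices below, where the factor
    \<open>\<eta>\<^sup>2\<close> compensates for \<open>T\<close>.\<close>
  then have SA': "S \<le> A / (c * \<mu>) * real T"
    using qq A c \<mu> by (smt (verit) divide_nonneg_nonneg mult_left_mono mult_nonneg_nonneg)
  have "(\<Sum>t<T. gsq t) \<le> (\<Sum>t<T. 3 * L\<^sup>2 * err (d t) + K)"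
    unfolding K_def by (intro sum_mono gsq_le) simp
  also have "\<dots> = 3 * L\<^sup>2 * S + real T * K"
    by (simp add: S_def sum.distrib sum_distrib_left)
  also have "\<dots> \<le> 3 * L\<^sup>2 * (A / (c * \<mu>) * real T) + real T * K"
    using SA' by (intro add_right_mono mult_left_mono) auto
  finally have "\<eta>\<^sup>2 * (real \<tau>)\<^sup>2 * (\<Sum>t<T. gsq t)
      \<le> \<eta>\<^sup>2 * (real \<tau>)\<^sup>2 * (3 * L\<^sup>2 * (A / (c * \<mu>) * real T) + real T * K)"
    by (intro mult_left_mono) auto
  also have "\<dots> = (\<eta>\<^sup>2 * real T) * (real \<tau>)\<^sup>2 * (3 * L\<^sup>2 * (A / (c * \<mu>)) + K)"
    by (simp add: algebra_simps)
  also have "\<dots> = B" by (simp add: \<eta>2 B_def)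
  finally have "(\<Sum>t<T. err t) \<le> 2 * (A / (c * \<mu>) * q) + 2 * B"
    using sum_err_le SA by (simp add: S_def)
  \<comment> \<open>The sums so far stop before \<open>T\<close>; the last iterate is added through
    \<open>errT\<close>.\<close>
  then have "(\<Sum>t=0..T. err t) \<le> 2 * (A / (c * \<mu>) * q) + 2 * B + A"
    using errT by (simp add: atLeast0AtMost lessThan_Suc_atMost[symmetric])
  also have "\<dots> \<le> (2 * (A / (c * \<mu>)) + 2 * B + A) * q"
  proof -
    have "B \<ge> 0" using A K c \<mu> by (simp add: B_def)
    then have "(2 * B + A) * 1 \<le> (2 * B + A) * q"
      using A q by (intro mult_left_mono) auto
    then show ?thesis by (simp add: algebra_simps)
  qed
  finally have "(\<Sum>t=0..T. err t) \<le> (2 * (A / (c * \<mu>)) + 2 * B + A) * q" .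
  \<comment> \<open>Giving up the \<open>+ 1\<close> makes the divisor \<open>q\<^sup>2\<close>, one
    factor of which cancels.\<close>
  moreover have "(\<Sum>t=0..T. err t) / real (T + 1) \<le> (\<Sum>t=0..T. err t) / real T"
    using T by (intro divide_left_mono sum_nonneg err_nonneg) auto
  moreover have "\<dots> = (\<Sum>t=0..T. err t) / q / q"
    by (simp add: q(2)[symmetric] power2_eq_square)
  ultimately have "(\<Sum>t=0..T. err t) / real (T + 1) \<le> (2 * (A / (c * \<mu>)) + 2 * B + A) * q / q / q"
    using q by (smt (verit) divide_right_mono)
  also have "\<dots> = (2 * (A / (c * \<mu>)) + 2 * B + A) / q" using q by simp
  finally show ?thesis using running_average_err(2) by (simp add: q_def rate)
qed

end

text \<open>The step size is quantified before the problem, so it can depend on nothing but its four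
  arguments. Integrability is part of the conclusion because the integral of a non-integrable
  function is 0 by convention, and the bound alone would then say nothing.\<close>

theorem theorem2:
  shows "\<exists>\<eta> :: real \<Rightarrow> real \<Rightarrow> nat \<Rightarrow> nat \<Rightarrow> real.
    (\<forall>\<mu>>0. \<forall>L>0. \<forall>\<tau>.
       (\<forall>T\<ge>1. \<eta> \<mu> L \<tau> T > 0) \<and> (\<lambda>T. \<eta> \<mu> L \<tau> T) \<in> O(\<lambda>T. 1 / sqrt (real T))) \<and>
    (\<forall>(n::nat) (m::nat) (f :: nat \<Rightarrow> fvec \<Rightarrow> real) (h :: fvec \<Rightarrow> real)
       (\<mu>::real) (L::real) (C\<^sub>f::real) (C\<^sub>h::real) (xstar::fvec) (x0::fvec) (\<tau>::nat).
       n \<ge> 1 \<longrightarrow> m \<ge> 1 \<longrightarrow> \<mu> > 0 \<longrightarrow> L > 0 \<longrightarrow> C\<^sub>f \<ge> 0 \<longrightarrow> C\<^sub>h \<ge> 0 \<longrightarrow>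
       (\<forall>i\<in>{1..n}. f i differentiable_on Rdim m) \<longrightarrow>
       strongly_convex m \<mu> (average n f) \<longrightarrow>
       convex_on (Rdim m) h \<longrightarrow>
       L-lipschitz_on (Rdim m) (gradient m (average n f)) \<longrightarrow>
       (\<forall>x\<in>Rdim m.
          1 / real n * (\<Sum>i=1..n. (norm (gradient m (f i) x - gradient m (average n f) x))\<^sup>2) \<le> C\<^sub>f) \<longrightarrow>
       (\<forall>x\<in>Rdim m. \<forall>g\<in>subdifferential m h x. (norm g)\<^sup>2 \<le> C\<^sub>h) \<longrightarrow>
       is_arg_min (\<lambda>x. average n f x + h x) (\<lambda>x. x \<in> Rdim m) xstar \<longrightarrow>
       x0 \<in> Rdim m \<longrightarrow>
       (\<exists>C::real. \<forall>T\<ge>1. \<forall>d M x.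
          delay_seq \<tau> d \<longrightarrow>
          dap_sgd m n f h (\<lambda>_. \<eta> \<mu> L \<tau> T) d x0 T M x \<longrightarrow>
          integrable M (\<lambda>\<omega>. (norm (running_average T x \<omega> - xstar))\<^sup>2) \<and>
          (\<integral>\<omega>. (norm (running_average T x \<omega> - xstar))\<^sup>2 \<partial>M) \<le> C / sqrt (real T)))"
proof -
  \<comment> \<open>The largest constant that meets the absorption condition
    \<open>6 * (1 + \<tau>) * L\<^sup>2 * c \<le> \<mu>\<close>.\<close>
  define c where "c \<mu> L \<tau> = \<mu> / (6 * (1 + real \<tau>) * L\<^sup>2)" for \<mu> L :: real and \<tau> :: nat
  have c: "c \<mu> L \<tau> > 0" "6 * (1 + real \<tau>) * L\<^sup>2 * c \<mu> L \<tau> = \<mu>" if "\<mu> > 0" "L > 0" for \<mu> L \<tau>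
  proof -
    have "6 * (1 + real \<tau>) * L\<^sup>2 > 0" using that by (simp add: add_pos_nonneg)
    then show "c \<mu> L \<tau> > 0" "6 * (1 + real \<tau>) * L\<^sup>2 * c \<mu> L \<tau> = \<mu>"
      unfolding c_def using that by auto
  qed
  show ?thesis
  proof (intro exI[of _ "\<lambda>\<mu> L \<tau> T. c \<mu> L \<tau> / sqrt (real T)"] conjI allI impI)
    fix \<mu> L :: real and \<tau> T :: nat
    assume "\<mu> > 0" "L > 0"
    then show "T \<ge> 1 \<Longrightarrow> c \<mu> L \<tau> / sqrt (real T) > 0" using c by simp
    \<comment> \<open>The estimate holds even at \<open>T = 0\<close>, where division by zero makes
      both sides vanish.\<close>
    show "(\<lambda>T. c \<mu> L \<tau> / sqrt (real T)) \<in> O(\<lambda>T. 1 / sqrt (real T))"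
      by (intro bigoI[of _ "\<bar>c \<mu> L \<tau>\<bar>"]) (simp add: abs_divide)
  next
    fix n m :: nat and f :: "nat \<Rightarrow> fvec \<Rightarrow> real" and h :: "fvec \<Rightarrow> real"
      and \<mu> L Cf Ch :: real and xstar x0 :: fvec and \<tau> :: nat
    assume A: "n \<ge> 1" "\<mu> > 0" "L > 0" and C: "Cf \<ge> 0" "Ch \<ge> 0"
      and B: "\<forall>i\<in>{1..n}. f i differentiable_on Rdim m"
       "strongly_convex m \<mu> (average n f)"
       "convex_on (Rdim m) h"
       "L-lipschitz_on (Rdim m) (gradient m (average n f))"
       "\<forall>x\<in>Rdim m.
          1 / real n * (\<Sum>i=1..n. (norm (gradient m (f i) x - gradient m (average n f) x))\<^sup>2) \<le> Cf"
       "\<forall>x\<in>Rdim m. \<forall>g\<in>subdifferential m h x. (norm g)\<^sup>2 \<le> Ch"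
       "is_arg_min (\<lambda>x. average n f x + h x) (\<lambda>x. x \<in> Rdim m) xstar"
      and x0: "x0 \<in> Rdim m"
    interpret P: composite_problem m n f h \<mu> L Cf Ch xstar
      using A B by unfold_locales auto
    have run: "dap_sgd_run m n f h \<mu> L Cf Ch xstar M (c \<mu> L \<tau> / sqrt (real T)) d x0 T \<tau> x"
      if "T \<ge> 1" "delay_seq \<tau> d" "dap_sgd m n f h (\<lambda>_. c \<mu> L \<tau> / sqrt (real T)) d x0 T M x"
      for T d M x
    proof -
      interpret prob_space M using that by (simp add: dap_sgd_def)
      show ?thesis
        by unfold_locales (use that x0 c[OF A(2,3)] in auto)
    qed
    show "\<exists>C. \<forall>T\<ge>1. \<forall>d M x. delay_seq \<tau> d \<longrightarrow>
          dap_sgd m n f h (\<lambda>_. c \<mu> L \<tau> / sqrt (real T)) d x0 T M x \<longrightarrow>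
          integrable M (\<lambda>\<omega>. (norm (running_average T x \<omega> - xstar))\<^sup>2) \<and>
          (\<integral>\<omega>. (norm (running_average T x \<omega> - xstar))\<^sup>2 \<partial>M) \<le> C / sqrt (real T)"
      using dap_sgd_run.integrable_running_average[OF run]
        dap_sgd_run.convergence_rate[OF run _ C c[OF A(2,3)] refl]
      by (intro exI[of _ "P.rate_const x0 \<tau> (c \<mu> L \<tau>)"]) blast
  qed
qed

end
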